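(* Let $\phi$ be a totally complex holomorphic immersion of a complex manifold $(M,J)$ into $V=T^*\mathbb{C}^n$, $n=\dim_{\mathbb{C}}M$, let $\nabla$ be the induced connection and $\omega=2\phi^*(\sum_{i=1}^n dx^i\wedge dy_i)$ the induced symplectic form. Then: (i) $(M,J,\nabla,\omega)$ is a special symplectic manifold. (ii) The pull back via $\phi$ of the functions $(x^1=\mathrm{Re}\,z^1,\dots,x^n=\mathrm{Re}\,z^n,\ y_1=\mathrm{Re}\,w_1,\dots,y_n=\mathrm{Re}\,w_n)$ of $V$ defines a real special coordinate system around each point of $M$.
   Context: A special complex manifold $(M,J,\nabla)$ is a complex manifold $(M,J)$ together with a flat torsionfree connection $\nabla$ on its real tangent bundle such that $d^\nabla J=0$, i.e. $(\nabla_XJ)Y=(\nabla_YJ)X$ for all $X,Y$. A special symplectic manifold $(M,J,\nabla,\omega)$ is a special complex manifold together with a $\nabla$-parallel symplectic form $\omega$. On a special symplectic manifold, a real special coordinate system is a local coordinate system $(x^1,\dots,x^n,y_1,\dots,y_n)$ consisting of $\nabla$-affine functions (functions $f$ with $\nabla df=0$) such that $\omega=2\sum dx^i\wedge dy_i$. $V=T^*\mathbb{C}^n=\mathbb{C}^{2n}$ has canonical coordinates $(z^1,\dots,z^n,w_1,\dots,w_n)$ and standard real structure $\tau$ (complex conjugation) with fixed point set $V^\tau=T^*\mathbb{R}^n=\mathbb{R}^{2n}$. Put $x^i=\mathrm{Re}\,z^i$, $y_i=\mathrm{Re}\,w_i$. A holomorphic immersion $\phi:M\to V$ of a connected complex $n$-fold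 is totally complex if $V^\tau\cap d\phi(T_pM)=0$ for all $p\in M$. In this case the functions $x^i\circ\phi,\ y_j\circ\phi$ are local coordinates around each point of $M$; the induced connection $\nabla$ is the flat torsionfree connection on $M$ for which these functions are affine, and the induced symplectic form is $\omega=2\phi^*(\sum dx^i\wedge dy_i)$. *)

theory Defs
  imports "HOL-Analysis.Analysis" "HOL-Library.Function_Algebras"
begin

section \<open>Smooth and holomorphic maps between vector spaces\<close>

text \<open>Only used on open sets \<open>S\<close>.\<close>

fun Ck_on :: "nat \<Rightarrow> 'a::euclidean_space set \<Rightarrow> ('a \<Rightarrow> 'b::real_normed_vector) \<Rightarrow> bool" where
  "Ck_on 0 S f \<longleftrightarrow> continuous_on S f"
| "Ck_on (Suc k) S f \<longleftrightarrow> (\<forall>x\<in>S. f differentiable (at x)) \<and>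
     (\<forall>v. Ck_on k S (\<lambda>x. frechet_derivative f (at x) v))"

definition smooth_on :: "'a::euclidean_space set \<Rightarrow> ('a \<Rightarrow> 'b::real_normed_vector) \<Rightarrow> bool" where
  "smooth_on S f \<longleftrightarrow> (\<forall>k. Ck_on k S f)"

text \<open>Holomorphic in several variables: smooth with complex linear differential, i.e. smooth
  and satisfying the Cauchy--Riemann equations.\<close>

definition holo_on :: "(complex ^ 'n) set \<Rightarrow> (complex ^ 'n \<Rightarrow> complex ^ 'm) \<Rightarrow> bool" where
  "holo_on S f \<longleftrightarrow> smooth_on S f \<and>
     (\<forall>x\<in>S. \<forall>v. frechet_derivative f (at x) (\<i> *s v) = \<i> *s frechet_derivative f (at x) v)"

section \<open>Complex manifolds\<close>

text \<open>A chart is a pair of its domain and its coordinate map; the values of the map outside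
  the domain are irrelevant. The manifold is the whole type \<open>'m\<close>.\<close>

type_synonym ('m, 'n) chart = "'m set \<times> ('m \<Rightarrow> complex ^ 'n)"

definition is_chart :: "('m::topological_space, 'n::finite) chart \<Rightarrow> bool" where
  "is_chart c \<longleftrightarrow> open (fst c) \<and> open (snd c ` fst c) \<and>
     homeomorphism (fst c) (snd c ` fst c) (snd c) (inv_into (fst c) (snd c))"

definition complex_manifold ::
  "('m::{t2_space, second_countable_topology}, 'n::finite) chart set \<Rightarrow> bool" where
  "complex_manifold A \<longleftrightarrow>
     (\<forall>c\<in>A. is_chart c) \<and> (\<Union>c\<in>A. fst c) = UNIV \<and>
     (\<forall>c\<in>A. \<forall>c'\<in>A. holo_on (snd c ` (fst c \<inter> fst c')) (snd c' \<circ> inv_into (fst c) (snd c)))"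

definition smooth_map_on ::
  "('m, 'n::finite) chart set \<Rightarrow> 'm set \<Rightarrow> ('m \<Rightarrow> 'b::real_normed_vector) \<Rightarrow> bool" where
  "smooth_map_on A U f \<longleftrightarrow>
     (\<forall>c\<in>A. smooth_on (snd c ` (fst c \<inter> U)) (f \<circ> inv_into (fst c) (snd c)))"

definition holomorphic_map ::
  "('m, 'n::finite) chart set \<Rightarrow> ('m \<Rightarrow> complex ^ 'k) \<Rightarrow> bool" where
  "holomorphic_map A f \<longleftrightarrow> (\<forall>c\<in>A. holo_on (snd c ` fst c) (f \<circ> inv_into (fst c) (snd c)))"

section \<open>Tangent vectors and vector fields\<close>

text \<open>A tangent vector at \<open>p\<close> is the family of its components in all charts around \<open>p\<close>,
  related by the differentials of the coordinate changes. The components in all other charts are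
  set to \<open>0\<close>, so that equality of tangent vectors is equality of functions. Addition,
  subtraction and \<open>0\<close> of tangent vectors and of vector fields are the pointwise operations.\<close>

type_synonym ('m, 'n) tvec = "('m, 'n) chart \<Rightarrow> complex ^ 'n"
type_synonym ('m, 'n) vfield = "'m \<Rightarrow> ('m, 'n) tvec"

definition tangent_space ::
  "('m, 'n::finite) chart set \<Rightarrow> 'm \<Rightarrow> ('m, 'n) tvec set" where
  "tangent_space A p = {v.
     (\<forall>c\<in>A. \<forall>c'\<in>A. p \<in> fst c \<longrightarrow> p \<in> fst c' \<longrightarrow>
        v c' = frechet_derivative (snd c' \<circ> inv_into (fst c) (snd c)) (at (snd c p)) (v c)) \<and>
     (\<forall>c. \<not> (c \<in> A \<and> p \<in> fst c) \<longrightarrow> v c = 0)}"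

definition tscale :: "real \<Rightarrow> ('m, 'n::finite) tvec \<Rightarrow> ('m, 'n) tvec" where
  "tscale a v = (\<lambda>c. a *\<^sub>R v c)"

text \<open>The almost complex structure. It is multiplication by \<open>\<i>\<close> in every chart.\<close>

definition J :: "('m, 'n::finite) tvec \<Rightarrow> ('m, 'n) tvec" where
  "J v = (\<lambda>c. \<i> *s v c)"

text \<open>\<open>diff A f p\<close> is the differential \<open>T\<^sub>p M \<rightarrow> 'b\<close> of \<open>f\<close> at \<open>p\<close>; it does not depend
  on the selected chart.\<close>

definition diff ::
  "('m, 'n::finite) chart set \<Rightarrow> ('m \<Rightarrow> 'b::real_normed_vector) \<Rightarrow> 'm \<Rightarrow> ('m, 'n) tvec \<Rightarrow> 'b" where
  "diff A f p v = (let c = (SOME c. c \<in> A \<and> p \<in> fst c) in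
     frechet_derivative (f \<circ> inv_into (fst c) (snd c)) (at (snd c p)) (v c))"

definition vector_field :: "('m, 'n::finite) chart set \<Rightarrow> ('m, 'n) vfield \<Rightarrow> bool" where
  "vector_field A X \<longleftrightarrow> (\<forall>p. X p \<in> tangent_space A p) \<and>
     (\<forall>c\<in>A. smooth_on (snd c ` fst c) (\<lambda>x. X (inv_into (fst c) (snd c) x) c))"

definition fscale :: "('m \<Rightarrow> real) \<Rightarrow> ('m, 'n::finite) vfield \<Rightarrow> ('m, 'n) vfield" where
  "fscale f X = (\<lambda>p. tscale (f p) (X p))"

definition Jfield :: "('m, 'n::finite) vfield \<Rightarrow> ('m, 'n) vfield" where
  "Jfield X = (\<lambda>p. J (X p))"

definition deriv_along ::
  "('m, 'n::finite) chart set \<Rightarrow> ('m, 'n) vfield \<Rightarrow> ('m \<Rightarrow> real) \<Rightarrow> 'm \<Rightarrow> real" where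
  "deriv_along A X f = (\<lambda>p. diff A f p (X p))"

text \<open>In a chart, \<open>[X, Y] = DY(X) - DX(Y)\<close>.\<close>

definition lie_bracket ::
  "('m, 'n::finite) chart set \<Rightarrow> ('m, 'n) vfield \<Rightarrow> ('m, 'n) vfield \<Rightarrow> ('m, 'n) vfield" where
  "lie_bracket A X Y = (\<lambda>p c.
     if c \<in> A \<and> p \<in> fst c then
       frechet_derivative (\<lambda>x. Y (inv_into (fst c) (snd c) x) c) (at (snd c p)) (X p c) -
       frechet_derivative (\<lambda>x. X (inv_into (fst c) (snd c) x) c) (at (snd c p)) (Y p c)
     else 0)"

section \<open>Connections on the real tangent bundle\<close>

type_synonym ('m, 'n) conn = "('m, 'n) vfield \<Rightarrow> ('m, 'n) vfield \<Rightarrow> ('m, 'n) vfield"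

text \<open>\<open>D X Y\<close> stands for \<open>\<nabla>\<^sub>X Y\<close>. The last condition only normalises the values on
  arguments that are not smooth vector fields, so that two connections are equal as functions
  iff they agree on smooth vector fields.\<close>

definition connection :: "('m, 'n::finite) chart set \<Rightarrow> ('m, 'n) conn \<Rightarrow> bool" where
  "connection A D \<longleftrightarrow>
     (\<forall>X Y. vector_field A X \<longrightarrow> vector_field A Y \<longrightarrow> vector_field A (D X Y)) \<and>
     (\<forall>X X' Y. vector_field A X \<longrightarrow> vector_field A X' \<longrightarrow> vector_field A Y \<longrightarrow>
        D (X + X') Y = D X Y + D X' Y) \<and>
     (\<forall>f X Y. smooth_map_on A UNIV f \<longrightarrow> vector_field A X \<longrightarrow> vector_field A Y \<longrightarrow>
        D (fscale f X) Y = fscale f (D X Y)) \<and>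
     (\<forall>X Y Y'. vector_field A X \<longrightarrow> vector_field A Y \<longrightarrow> vector_field A Y' \<longrightarrow>
        D X (Y + Y') = D X Y + D X Y') \<and>
     (\<forall>f X Y. smooth_map_on A UNIV f \<longrightarrow> vector_field A X \<longrightarrow> vector_field A Y \<longrightarrow>
        D X (fscale f Y) = fscale (deriv_along A X f) Y + fscale f (D X Y)) \<and>
     (\<forall>X Y. \<not> (vector_field A X \<and> vector_field A Y) \<longrightarrow> D X Y = 0)"

definition flat :: "('m, 'n::finite) chart set \<Rightarrow> ('m, 'n) conn \<Rightarrow> bool" where
  "flat A D \<longleftrightarrow> (\<forall>X Y Z. vector_field A X \<longrightarrow> vector_field A Y \<longrightarrow> vector_field A Z \<longrightarrow>
     D X (D Y Z) - D Y (D X Z) - D (lie_bracket A X Y) Z = 0)"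

definition torsionfree :: "('m, 'n::finite) chart set \<Rightarrow> ('m, 'n) conn \<Rightarrow> bool" where
  "torsionfree A D \<longleftrightarrow> (\<forall>X Y. vector_field A X \<longrightarrow> vector_field A Y \<longrightarrow>
     D X Y - D Y X = lie_bracket A X Y)"

text \<open>The tensor \<open>\<nabla>J\<close>: \<open>nablaJ D X Y = (\<nabla>\<^sub>X J) Y\<close>.\<close>

definition nablaJ ::
  "('m, 'n::finite) conn \<Rightarrow> ('m, 'n) vfield \<Rightarrow> ('m, 'n) vfield \<Rightarrow> ('m, 'n) vfield" where
  "nablaJ D X Y = D X (Jfield Y) - Jfield (D X Y)"

text \<open>\<open>f\<close> is affine on the open set \<open>U\<close> if \<open>(\<nabla> df)(X, Y) = X (Y f) - df (\<nabla>\<^sub>X Y)\<close> vanishes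
  on \<open>U\<close>.\<close>

definition affine_on ::
  "('m, 'n::finite) chart set \<Rightarrow> ('m, 'n) conn \<Rightarrow> 'm set \<Rightarrow> ('m \<Rightarrow> real) \<Rightarrow> bool" where
  "affine_on A D U f \<longleftrightarrow> smooth_map_on A U f \<and>
     (\<forall>X Y. vector_field A X \<longrightarrow> vector_field A Y \<longrightarrow>
        (\<forall>p\<in>U. deriv_along A X (deriv_along A Y f) p - diff A f p (D X Y p) = 0))"

section \<open>Symplectic forms\<close>

type_synonym ('m, 'n) form2 = "'m \<Rightarrow> ('m, 'n) tvec \<Rightarrow> ('m, 'n) tvec \<Rightarrow> real"

definition wedge :: "('v \<Rightarrow> real) \<Rightarrow> ('v \<Rightarrow> real) \<Rightarrow> 'v \<Rightarrow> 'v \<Rightarrow> real" where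
  "wedge \<alpha> \<beta> u v = \<alpha> u * \<beta> v - \<alpha> v * \<beta> u"

definition two_form :: "('m, 'n::finite) chart set \<Rightarrow> ('m, 'n) form2 \<Rightarrow> bool" where
  "two_form A \<omega> \<longleftrightarrow>
     (\<forall>p. \<forall>u\<in>tangent_space A p. \<forall>v\<in>tangent_space A p. \<forall>w\<in>tangent_space A p. \<forall>a.
        \<omega> p (u + v) w = \<omega> p u w + \<omega> p v w \<and> \<omega> p (tscale a u) w = a * \<omega> p u w \<and>
        \<omega> p u v = - \<omega> p v u) \<and>
     (\<forall>X Y. vector_field A X \<longrightarrow> vector_field A Y \<longrightarrow>
        smooth_map_on A UNIV (\<lambda>p. \<omega> p (X p) (Y p)))"

definition nondegenerate :: "('m, 'n::finite) chart set \<Rightarrow> ('m, 'n) form2 \<Rightarrow> bool" where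
  "nondegenerate A \<omega> \<longleftrightarrow> (\<forall>p. \<forall>u\<in>tangent_space A p.
     (\<forall>v\<in>tangent_space A p. \<omega> p u v = 0) \<longrightarrow> u = 0)"

definition closed_form :: "('m, 'n::finite) chart set \<Rightarrow> ('m, 'n) form2 \<Rightarrow> bool" where
  "closed_form A \<omega> \<longleftrightarrow> (\<forall>X Y Z. vector_field A X \<longrightarrow> vector_field A Y \<longrightarrow> vector_field A Z \<longrightarrow>
     (\<forall>p. deriv_along A X (\<lambda>q. \<omega> q (Y q) (Z q)) p
        + deriv_along A Y (\<lambda>q. \<omega> q (Z q) (X q)) p
        + deriv_along A Z (\<lambda>q. \<omega> q (X q) (Y q)) p
        - \<omega> p (lie_bracket A X Y p) (Z p)
        - \<omega> p (lie_bracket A Y Z p) (X p)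
        - \<omega> p (lie_bracket A Z X p) (Y p) = 0))"

definition symplectic_form :: "('m, 'n::finite) chart set \<Rightarrow> ('m, 'n) form2 \<Rightarrow> bool" where
  "symplectic_form A \<omega> \<longleftrightarrow> two_form A \<omega> \<and> closed_form A \<omega> \<and> nondegenerate A \<omega>"

definition parallel_form ::
  "('m, 'n::finite) chart set \<Rightarrow> ('m, 'n) conn \<Rightarrow> ('m, 'n) form2 \<Rightarrow> bool" where
  "parallel_form A D \<omega> \<longleftrightarrow>
     (\<forall>X Y Z. vector_field A X \<longrightarrow> vector_field A Y \<longrightarrow> vector_field A Z \<longrightarrow>
       (\<forall>p. deriv_along A X (\<lambda>q. \<omega> q (Y q) (Z q)) p
          - \<omega> p (D X Y p) (Z p) - \<omega> p (Y p) (D X Z p) = 0))"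

section \<open>Special complex and special symplectic manifolds\<close>

definition special_complex_manifold ::
  "('m::{t2_space, second_countable_topology}, 'n::finite) chart set \<Rightarrow> ('m, 'n) conn \<Rightarrow> bool" where
  "special_complex_manifold A D \<longleftrightarrow>
     complex_manifold A \<and> connection A D \<and> flat A D \<and> torsionfree A D \<and>
     (\<forall>X Y. vector_field A X \<longrightarrow> vector_field A Y \<longrightarrow> nablaJ D X Y = nablaJ D Y X)"

definition special_symplectic_manifold ::
  "('m::{t2_space, second_countable_topology}, 'n::finite) chart set \<Rightarrow> ('m, 'n) conn \<Rightarrow>
   ('m, 'n) form2 \<Rightarrow> bool" where
  "special_symplectic_manifold A D \<omega> \<longleftrightarrow>
     special_complex_manifold A D \<and> symplectic_form A \<omega> \<and> parallel_form A D \<omega>"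

text \<open>\<open>\<xi>\<close> restricts to a diffeomorphism from the open set \<open>U\<close> onto an open subset of \<open>'b\<close>.\<close>

definition local_coordinates ::
  "('m::topological_space, 'n::finite) chart set \<Rightarrow> 'm set \<Rightarrow> ('m \<Rightarrow> 'b::euclidean_space) \<Rightarrow> bool" where
  "local_coordinates A U \<xi> \<longleftrightarrow>
     open U \<and> inj_on \<xi> U \<and> open (\<xi> ` U) \<and> smooth_map_on A U \<xi> \<and>
     (\<forall>c\<in>A. smooth_on (\<xi> ` (U \<inter> fst c)) (snd c \<circ> inv_into U \<xi>))"

definition real_special_coordinates ::
  "('m::topological_space, 'n::finite) chart set \<Rightarrow> ('m, 'n) conn \<Rightarrow> ('m, 'n) form2 \<Rightarrow> 'm set \<Rightarrow>
   ('m \<Rightarrow> real ^ 'n) \<Rightarrow> ('m \<Rightarrow> real ^ 'n) \<Rightarrow> bool" where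
  "real_special_coordinates A D \<omega> U x y \<longleftrightarrow>
     local_coordinates A U (\<lambda>q. (x q, y q)) \<and>
     (\<forall>i. affine_on A D U (\<lambda>q. x q $ i) \<and> affine_on A D U (\<lambda>q. y q $ i)) \<and>
     (\<forall>p\<in>U. \<forall>u\<in>tangent_space A p. \<forall>v\<in>tangent_space A p.
        \<omega> p u v = 2 * (\<Sum>i\<in>UNIV. wedge (diff A (\<lambda>q. x q $ i) p) (diff A (\<lambda>q. y q $ i) p) u v))"

section \<open>Totally complex immersions into \<open>V = T\<^sup>*\<complex>\<^sup>n\<close>\<close>

text \<open>\<open>V = \<complex>\<^sup>2\<^sup>n\<close> with index type \<open>'n + 'n\<close>: \<open>z\<^sup>i\<close> and \<open>w\<^sub>i\<close> are the coordinates with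
  index \<open>Inl i\<close> and \<open>Inr i\<close>.\<close>

type_synonym 'n cotangent = "complex ^ ('n + 'n)"

definition xV :: "'n::finite \<Rightarrow> 'n cotangent \<Rightarrow> real" where
  "xV i v = Re (v $ Inl i)"

definition yV :: "'n::finite \<Rightarrow> 'n cotangent \<Rightarrow> real" where
  "yV i v = Re (v $ Inr i)"

definition \<tau> :: "'n::finite cotangent \<Rightarrow> 'n cotangent" where
  "\<tau> v = (\<chi> k. cnj (v $ k))"

definition real_points :: "'n::finite cotangent set" where
  "real_points = {v. \<tau> v = v}"

definition holomorphic_immersion ::
  "('m, 'n::finite) chart set \<Rightarrow> ('m \<Rightarrow> complex ^ 'k) \<Rightarrow> bool" where
  "holomorphic_immersion A \<phi> \<longleftrightarrow> holomorphic_map A \<phi> \<and>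
     (\<forall>p. inj_on (diff A \<phi> p) (tangent_space A p))"

definition totally_complex_immersion ::
  "('m::topological_space, 'n::finite) chart set \<Rightarrow> ('m \<Rightarrow> 'n cotangent) \<Rightarrow> bool" where
  "totally_complex_immersion A \<phi> \<longleftrightarrow>
     connected (UNIV :: 'm set) \<and> holomorphic_immersion A \<phi> \<and>
     (\<forall>p. real_points \<inter> diff A \<phi> p ` tangent_space A p = {0})"

definition induced_connection ::
  "('m, 'n::finite) chart set \<Rightarrow> ('m \<Rightarrow> 'n cotangent) \<Rightarrow> ('m, 'n) conn" where
  "induced_connection A \<phi> = (THE D. connection A D \<and> flat A D \<and> torsionfree A D \<and>
     (\<forall>i. affine_on A D UNIV (xV i \<circ> \<phi>) \<and> affine_on A D UNIV (yV i \<circ> \<phi>)))"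

text \<open>The form \<open>\<Sum> dx\<^sup>i \<and> dy\<^sub>i\<close> on \<open>V\<close> at the point \<open>a\<close>.\<close>

definition dx_dy :: "'n::finite cotangent \<Rightarrow> 'n cotangent \<Rightarrow> 'n cotangent \<Rightarrow> real" where
  "dx_dy a u v =
     (\<Sum>i\<in>UNIV. wedge (frechet_derivative (xV i) (at a)) (frechet_derivative (yV i) (at a)) u v)"

definition induced_form ::
  "('m, 'n::finite) chart set \<Rightarrow> ('m \<Rightarrow> 'n cotangent) \<Rightarrow> ('m, 'n) form2" where
  "induced_form A \<phi> = (\<lambda>p u v. 2 * dx_dy (\<phi> p) (diff A \<phi> p u) (diff A \<phi> p v))"

end

theory Submission
  imports Defs
begin

text \<open>
  Let \<open>W = Re \<circ> \<phi>\<close> with values in \<open>T\<^sup>*\<real>\<^sup>n\<close>. A tangent vector killed by \<open>dW\<close> is sent by \<open>d\<phi>\<close> to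
  \<open>\<i>\<close> times a real point, and since \<open>d\<phi>(TM)\<close> is complex, total complexity forces it to vanish. So
  \<open>W\<close> is a local diffeomorphism, and \<open>dW(\<nabla>\<^sub>X Y) = X(dW(Y))\<close> defines the only connection for which the
  components of \<open>W\<close> are affine. Applying \<open>dW\<close> to an identity between vector fields reduces it to
  \<open>X(Y f) - Y(X f) = [X, Y] f\<close>: with \<open>f = W\<close> this is torsionfreeness, with \<open>f = dW(Z)\<close> flatness, and
  with \<open>f = Re (\<i> \<phi>)\<close>, where \<open>df = dW \<circ> J\<close>, the symmetry of \<open>\<nabla>J\<close>. The form \<open>\<omega>\<close> is the pullback of
  a constant form under \<open>W\<close>, hence parallel, and closed because \<open>\<nabla>\<close> is torsionfree.
\<close>

section \<open>Calculus of smooth maps\<close>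

text \<open>Connections act on global vector fields only. This is harmless because \<open>W\<close>
  is globally defined: identities are tested by applying \<open>dW\<close>, without cut-off
  functions or local frames. Two analytic facts carry the weight. The pointwise solution
  \<open>Z\<close> of \<open>dW(Z) = g\<close> must be shown to be smooth; implicit differentiation
  of the linear system does this order by order, and it also makes the local inverse of
  \<open>W\<close> smooth, on which part (ii) rests. Symmetry of second derivatives lies behind
  every commutator identity. A further obstacle is that \<open>lie_bracket\<close> is given chart by
  chart, so it is not clear that it is a vector field; its components are first identified with
  those of \<open>nabla X Y - nabla Y X\<close>. Throughout, \<open>Ck_on\<close> speaks of
  derivatives in one fixed direction at a time, and expansion in a finite basis turns this into
  statements about whole linear maps.\<close>

lemma Ck_on_cong:
  assumes "open S" "\<And>x. x \<in> S \<Longrightarrow> f x = g x" "Ck_on k S f"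
  shows "Ck_on k S g"
  using assms(2,3)
proof (induction k arbitrary: f g)
  case 0
  then show ?case using continuous_on_cong by fastforce
next
  case (Suc k)
  have d: "f differentiable (at x)" if "x \<in> S" for x using Suc.prems(2) that by simp
  have "(g has_derivative frechet_derivative f (at x)) (at x)" if "x \<in> S" for x
    by (rule has_derivative_transform_within_open[OF _ assms(1) that Suc.prems(1)])
      (use d[OF that] frechet_derivative_works in auto)
  then have g: "g differentiable (at x)" "frechet_derivative f (at x) = frechet_derivative g (at x)"
    if "x \<in> S" for x
    using that frechet_derivative_at unfolding differentiable_def by blast+
  have "Ck_on k S (\<lambda>x. frechet_derivative g (at x) v)" for v
    by (rule Suc.IH[of "\<lambda>x. frechet_derivative f (at x) v"]) (use g Suc.prems(2) in simp_all)
  then show ?case using g by simp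
qed

lemma Ck_on_SucI:
  assumes "open S" "\<And>x. x \<in> S \<Longrightarrow> (f has_derivative f' x) (at x)"
    and "\<And>v. Ck_on k S (\<lambda>x. f' x v)"
  shows "Ck_on (Suc k) S f"
proof -
  have "f differentiable (at x)" "f' x = frechet_derivative f (at x)" if "x \<in> S" for x
    using assms(2)[OF that] frechet_derivative_at unfolding differentiable_def by blast+
  moreover have "Ck_on k S (\<lambda>x. frechet_derivative f (at x) v)" for v
    by (rule Ck_on_cong[OF assms(1) _ assms(3)[of v]]) (simp add: calculation)
  ultimately show ?thesis by simp
qed

lemma Ck_on_SucD:
  assumes "Ck_on (Suc k) S f"
  shows "x \<in> S \<Longrightarrow> (f has_derivative frechet_derivative f (at x)) (at x)"
    and "Ck_on k S (\<lambda>x. frechet_derivative f (at x) v)"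
  using assms frechet_derivative_works by auto

lemma Ck_on_lower: "Ck_on (Suc k) S f \<Longrightarrow> Ck_on k S f"
proof (induction k arbitrary: f)
  case 0
  then show ?case
    by (auto intro!: continuous_at_imp_continuous_on differentiable_imp_continuous_within)
next
  case (Suc k)
  then show ?case using Ck_on.simps(2) by blast
qed

lemma Ck_on_subset: "Ck_on k S f \<Longrightarrow> T \<subseteq> S \<Longrightarrow> Ck_on k T f"
  by (induction k arbitrary: f) (auto intro: continuous_on_subset)

lemma Ck_on_const: "open S \<Longrightarrow> Ck_on k S (\<lambda>x. c)"
proof (induction k arbitrary: c)
  case (Suc k)
  then show ?case by (intro Ck_on_SucI[where f'="\<lambda>_ _. 0"]) auto
qed auto

lemma Ck_on_linear_compose:
  assumes "bounded_linear L" "open S" "Ck_on k S f"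
  shows "Ck_on k S (\<lambda>x. L (f x))"
  using assms(3)
proof (induction k arbitrary: f)
  case 0
  then show ?case using bounded_linear.continuous_on[OF assms(1)] by auto
next
  case (Suc k)
  show ?case
    by (rule Ck_on_SucI[where f'="\<lambda>x v. L (frechet_derivative f (at x) v)", OF assms(2)])
      (use Suc Ck_on_SucD[OF Suc.prems] bounded_linear.has_derivative[OF assms(1)] in blast)+
qed

lemma Ck_on_add:
  assumes "open S" "Ck_on k S f" "Ck_on k S g"
  shows "Ck_on k S (\<lambda>x. f x + g x)"
  using assms(2,3)
proof (induction k arbitrary: f g)
  case 0
  then show ?case by (auto intro: continuous_intros)
next
  case (Suc k)
  show ?case
    by (rule Ck_on_SucI[OF assms(1) has_derivative_add])
      (use Suc Ck_on_SucD[OF Suc.prems(1)] Ck_on_SucD[OF Suc.prems(2)] in blast)+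
qed

lemma Ck_on_sum:
  assumes "open S" "\<And>i. i \<in> I \<Longrightarrow> Ck_on k S (f i)"
  shows "Ck_on k S (\<lambda>x. \<Sum>i\<in>I. f i x)"
proof (cases "finite I")
  case True
  then show ?thesis using assms(2)
    by (induction I) (auto intro: Ck_on_const Ck_on_add assms(1))
qed (auto intro: Ck_on_const assms(1))

lemma Ck_on_bilinear:
  assumes "bounded_bilinear b" "open S" "Ck_on k S f" "Ck_on k S g"
  shows "Ck_on k S (\<lambda>x. b (f x) (g x))"
  using assms(3,4)
proof (induction k arbitrary: f g)
  case 0
  then show ?case using bounded_bilinear.continuous_on[OF assms(1)] by auto
next
  case (Suc k)
  note F = Ck_on_SucD[OF Suc.prems(1)] and G = Ck_on_SucD[OF Suc.prems(2)]
  show ?case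
  proof (rule Ck_on_SucI[OF assms(2)])
    show "((\<lambda>x. b (f x) (g x)) has_derivative
       (\<lambda>v. b (f x) (frechet_derivative g (at x) v) + b (frechet_derivative f (at x) v) (g x))) (at x)"
      if "x \<in> S" for x
      by (rule bounded_bilinear.FDERIV[OF assms(1) F(1)[OF that] G(1)[OF that]])
    show "Ck_on k S (\<lambda>x. b (f x) (frechet_derivative g (at x) v)
       + b (frechet_derivative f (at x) v) (g x))" for v
      by (intro Ck_on_add assms(2) Suc.IH F(2) G(2) Ck_on_lower[OF Suc.prems(1)]
          Ck_on_lower[OF Suc.prems(2)])
  qed
qed

section \<open>Linear maps depending on a parameter, and composition\<close>

lemma linear_basis_expansion:
  fixes L :: "'a::euclidean_space \<Rightarrow> 'b::real_vector"
  assumes "linear L"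
  shows "L v = (\<Sum>b\<in>Basis. (v \<bullet> b) *\<^sub>R L b)"
proof -
  have "L v = L (\<Sum>b\<in>Basis. (v \<bullet> b) *\<^sub>R b)" by (simp add: euclidean_representation)
  then show ?thesis by (simp add: linear_sum[OF assms] linear_cmul[OF assms])
qed

text \<open>Expanding the moving argument in a finite basis reduces \<open>L x (g x)\<close> to
  products of scalar functions with the maps \<open>L x b\<close>, whose argument is fixed.\<close>

lemma Ck_on_apply:
  fixes L :: "'a::euclidean_space \<Rightarrow> 'b::euclidean_space \<Rightarrow> 'c::real_normed_vector"
  assumes "open S" "\<And>x. x \<in> S \<Longrightarrow> linear (L x)" "\<And>v. Ck_on k S (\<lambda>x. L x v)" "Ck_on k S g"
  shows "Ck_on k S (\<lambda>x. L x (g x))"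
proof (rule Ck_on_cong[OF assms(1)])
  show "Ck_on k S (\<lambda>x. \<Sum>b\<in>Basis. (g x \<bullet> b) *\<^sub>R L x b)"
    by (rule Ck_on_sum[OF assms(1)], rule Ck_on_bilinear[OF bounded_bilinear_scaleR assms(1) _ assms(3)],
        rule Ck_on_linear_compose[OF bounded_linear_inner_left assms(1,4)])
  show "(\<Sum>b\<in>Basis. (g x \<bullet> b) *\<^sub>R L x b) = L x (g x)" if "x \<in> S" for x
    by (rule linear_basis_expansion[OF assms(2)[OF that], symmetric])
qed

text \<open>By the chain rule the derivative is a linear map depending on \<open>g x\<close>,
  applied to a moving vector. At a fixed vector it is again a composition, one order lower;
  \<open>Ck_on_apply\<close> supplies the moving one.\<close>

lemma Ck_on_compose:
  fixes f :: "'b::euclidean_space \<Rightarrow> 'c::real_normed_vector"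
    and g :: "'a::euclidean_space \<Rightarrow> 'b"
  assumes "open S" "open T" "g ` S \<subseteq> T" "Ck_on k T f" "Ck_on k S g"
  shows "Ck_on k S (\<lambda>x. f (g x))"
  using assms(4,5)
proof (induction k arbitrary: f)
  case 0
  then show ?case using assms(3) by (auto intro: continuous_on_compose2)
next
  case (Suc k)
  note F = Ck_on_SucD[OF Suc.prems(1)] and G = Ck_on_SucD[OF Suc.prems(2)]
  have gT: "g x \<in> T" if "x \<in> S" for x using that assms(3) by blast
  show ?case
  proof (rule Ck_on_SucI[OF assms(1)])
    show "((\<lambda>x. f (g x)) has_derivative
       (\<lambda>v. frechet_derivative f (at (g x)) (frechet_derivative g (at x) v))) (at x)"
      if "x \<in> S" for x
      using has_derivative_compose[OF G(1)[OF that] F(1)[OF gT[OF that]]] .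
    show "Ck_on k S (\<lambda>x. frechet_derivative f (at (g x)) (frechet_derivative g (at x) v))" for v
    proof (rule Ck_on_apply[OF assms(1) _ _ G(2)])
      show "linear (frechet_derivative f (at (g x)))" if "x \<in> S" for x
        using F(1)[OF gT[OF that]] has_derivative_linear by blast
      show "Ck_on k S (\<lambda>x. frechet_derivative f (at (g x)) w)" for w
        using Suc.IH[OF F(2) Ck_on_lower[OF Suc.prems(2)]] .
    qed
  qed
qed

section \<open>Smooth dependence of the solution of a linear system\<close>

text \<open>The differences on basis vectors bound the operator norm, so convergence on each basis
  vector gives an estimate uniform in \<open>v\<close>.\<close>

lemma linear_image_perturbation:
  fixes L :: "'a::euclidean_space \<Rightarrow> 'b::real_normed_vector"
  assumes "linear L" "linear L'"
  shows "norm (L v - L' v) \<le> norm v * (\<Sum>b\<in>Basis. norm (L b - L' b))"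
proof -
  have "linear (\<lambda>v. L v - L' v)" using assms by (rule linear_compose_sub)
  then have "L v - L' v = (\<Sum>b\<in>Basis. (v \<bullet> b) *\<^sub>R (L b - L' b))"
    by (rule linear_basis_expansion)
  also have "norm \<dots> \<le> (\<Sum>b\<in>Basis. norm v * norm (L b - L' b))"
    by (rule sum_norm_le) (auto intro!: mult_right_mono Basis_le_norm)
  finally show ?thesis by (simp add: sum_distrib_left)
qed

text \<open>No continuity of \<open>h\<close> is assumed: \<open>L y\<close> is bounded below uniformly for \<open>y\<close> near \<open>x\<close>, so
  it suffices that \<open>L y (h y - h x - w (y - x)) = g y - L y (h x + w (y - x))\<close> is \<open>o(y - x)\<close>.\<close>

lemma has_derivative_solution:
  fixes L :: "'a::euclidean_space \<Rightarrow> 'b::euclidean_space \<Rightarrow> 'c::euclidean_space"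
  assumes "open S" "x \<in> S" "\<And>y. y \<in> S \<Longrightarrow> linear (L y)" "inj (L x)"
    and L': "\<And>v. ((\<lambda>y. L y v) has_derivative L' v) (at x)"
    and g': "(g has_derivative g') (at x)"
    and sol: "\<And>y. y \<in> S \<Longrightarrow> L y (h y) = g y"
    and w: "linear w" "\<And>v. L x (w v) = g' v - L' (h x) v"
  shows "(h has_derivative w) (at x)"
proof -
  obtain B where B: "B > 0" "\<And>v. B * norm v \<le> norm (L x v)"
    using linear_inj_bounded_below_pos[OF assms(3)[OF assms(2)] assms(4)] by metis
  \<comment> \<open>Near \<open>x\<close> the operator norm of \<open>L x - L y\<close> is below
    \<open>B / 2\<close>, which leaves \<open>B / 2\<close> of the lower bound \<open>B\<close> of
    \<open>L x\<close>.\<close>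
  have "((\<lambda>y. \<Sum>b\<in>Basis. norm (L x b - L y b)) \<longlongrightarrow> (\<Sum>b\<in>Basis. norm (L x b - L x b))) (at x)"
    using has_derivative_continuous[OF L'] by (intro tendsto_intros) (auto simp: continuous_at)
  then have "\<forall>\<^sub>F y in at x. (\<Sum>b\<in>Basis. norm (L x b - L y b)) < B / 2"
    using B(1) by (intro order_tendstoD) auto
  moreover have "\<forall>\<^sub>F y in at x. y \<in> S"
    using assms(1,2) eventually_at_topological by blast
  ultimately have lower: "\<forall>\<^sub>F y in at x. y \<in> S \<and> (\<forall>v. B / 2 * norm v \<le> norm (L y v))"
  proof eventually_elim
    case (elim y)
    have "B / 2 * norm v \<le> norm (L y v)" for v
    proof -
      have "norm (L x v - L y v) \<le> norm v * (\<Sum>b\<in>Basis. norm (L x b - L y b))"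
        using linear_image_perturbation assms(2,3) elim by blast
      also have "\<dots> \<le> norm v * (B / 2)"
        using elim by (intro mult_left_mono) auto
      finally show ?thesis
        using B(2)[of v] norm_triangle_ineq2[of "L x v" "L y v"] by (simp add: algebra_simps)
    qed
    then show ?case using elim by blast
  qed
  let ?q = "\<lambda>y. g y - L y (h x + w (y - x))"
  \<comment> \<open>In this form \<open>L y\<close> is applied to fixed vectors only, where its
    derivative \<open>L'\<close> is given; the moving vector sits in scalar coefficients.\<close>
  have qexp: "?q y = g y - L y (h x) - (\<Sum>b\<in>Basis. (w (y - x) \<bullet> b) *\<^sub>R L y b)" if "y \<in> S" for y
    using linear_add[OF assms(3)[OF that]] linear_basis_expansion[OF assms(3)[OF that], of "w (y - x)"]
    by simp
  have bw: "bounded_linear w" using w(1) linear_conv_bounded_linear by blast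
  have wd: "((\<lambda>y. w (y - x)) has_derivative w) (at x)"
    by (rule bounded_linear.has_derivative[OF bw]) (auto intro!: derivative_eq_intros)
  have "((\<lambda>y. g y - L y (h x) - (\<Sum>b\<in>Basis. (w (y - x) \<bullet> b) *\<^sub>R L y b)) has_derivative
    (\<lambda>v. g' v - L' (h x) v - (\<Sum>b\<in>Basis. (w (x - x) \<bullet> b) *\<^sub>R L' b v + (w v \<bullet> b) *\<^sub>R L x b))) (at x)"
    by (intro has_derivative_diff has_derivative_sum g' L' has_derivative_scaleR
        has_derivative_inner_left wd)
  \<comment> \<open>The terms with \<open>L' b\<close> carry a component of \<open>w 0 = 0\<close>,
    and what remains of the sum is \<open>L x (w v)\<close>, which equals
    \<open>g' v - L' (h x) v\<close> by the choice of \<open>w\<close>.\<close>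
  moreover have "g' v - L' (h x) v - (\<Sum>b\<in>Basis. (w (x - x) \<bullet> b) *\<^sub>R L' b v + (w v \<bullet> b) *\<^sub>R L x b) = 0" for v
    using linear_basis_expansion[OF assms(3)[OF assms(2)], of "w v"] w(2)[of v] linear_0[OF w(1)]
    by simp
  ultimately have "((\<lambda>y. g y - L y (h x) - (\<Sum>b\<in>Basis. (w (y - x) \<bullet> b) *\<^sub>R L y b)) has_derivative (\<lambda>v. 0)) (at x)"
    by simp
  then have qd: "(?q has_derivative (\<lambda>v. 0)) (at x)"
    by (rule has_derivative_transform_within_open[OF _ assms(1,2)]) (use qexp in simp)
  have q0: "?q x = 0" using sol[OF assms(2)] linear_0[OF w(1)] by simp
  have "((\<lambda>y. norm (?q y) / norm (y - x)) \<longlongrightarrow> 0) (at x)"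
    using qd[unfolded has_derivative_iff_norm q0] by simp
  then have lim: "((\<lambda>y. 2 / B * (norm (?q y) / norm (y - x))) \<longlongrightarrow> 0) (at x)"
    by (rule tendsto_mult_right_zero)
  have "((\<lambda>y. (h y - h x - w (y - x)) /\<^sub>R norm (y - x)) \<longlongrightarrow> 0) (at x)"
  proof (rule Lim_null_comparison[OF _ lim])
    show "\<forall>\<^sub>F y in at x. norm ((h y - h x - w (y - x)) /\<^sub>R norm (y - x))
        \<le> 2 / B * (norm (?q y) / norm (y - x))"
      using lower
    proof eventually_elim
      case (elim y)
      have "?q y = L y (h y - h x - w (y - x))"
        using elim sol[of y] linear_diff[OF assms(3)[of y], of "h y" "h x + w (y - x)"]
        by (simp add: diff_diff_eq)
      then have "B / 2 * norm (h y - h x - w (y - x)) \<le> norm (?q y)"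
        using elim by metis
      then have "norm (h y - h x - w (y - x)) \<le> 2 / B * norm (?q y)"
        using B(1) by (simp add: field_simps)
      then have "norm (h y - h x - w (y - x)) / norm (y - x) \<le> 2 / B * norm (?q y) / norm (y - x)"
        by (rule divide_right_mono) simp
      then show ?case by (simp add: divide_inverse_commute mult.assoc mult.left_commute)
    qed
  qed
  then show ?thesis using bw by (simp add: has_derivative_at_within)
qed

text \<open>For \<open>h x = M x (g x)\<close>, differentiating \<open>L h = g\<close> gives
  \<open>h' = M (g' - L' h)\<close>: the same system with a right-hand side containing
  \<open>h\<close> undifferentiated. The induction therefore runs over all right-hand sides at
  once.\<close>

lemma Ck_on_solution:
  fixes L M :: "'a::euclidean_space \<Rightarrow> 'b::euclidean_space \<Rightarrow> 'b"
  assumes S: "open S" and linL: "\<And>x. x \<in> S \<Longrightarrow> linear (L x)"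
    and linM: "\<And>x. x \<in> S \<Longrightarrow> linear (M x)"
    and left_inv: "\<And>x v. x \<in> S \<Longrightarrow> M x (L x v) = v" and right_inv: "\<And>x v. x \<in> S \<Longrightarrow> L x (M x v) = v"
    and L: "\<And>v k. Ck_on k S (\<lambda>x. L x v)" and g: "Ck_on k S g"
  shows "Ck_on k S (\<lambda>x. M x (g x))"
proof -
  define L' where "L' x w v = frechet_derivative (\<lambda>y. L y w) (at x) v" for x w v
  have L': "((\<lambda>y. L y w) has_derivative L' x w) (at x)" if "x \<in> S" for x w
    using Ck_on_SucD(1)[OF L that] unfolding L'_def[abs_def] .
  \<comment> \<open>\<open>Ck_on_apply\<close> will be used with \<open>M x (g x)\<close> in the
    slot \<open>w\<close>, so linearity in that slot is required, not in the direction
    \<open>v\<close>; uniqueness of derivatives transfers it from \<open>L\<close>.\<close>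
  have linL': "linear (\<lambda>w. L' x w v)" if x: "x \<in> S" for x v
  proof (rule linearI)
    fix u w and r :: real
    have "((\<lambda>y. L y (u + w)) has_derivative (\<lambda>v. L' x u v + L' x w v)) (at x)"
      by (rule has_derivative_transform_within_open[OF has_derivative_add[OF L'[OF x] L'[OF x]] S x])
        (simp add: linear_add[OF linL])
    then show "L' x (u + w) v = L' x u v + L' x w v"
      using has_derivative_unique[OF L'[OF x]] by metis
    have "((\<lambda>y. L y (r *\<^sub>R u)) has_derivative (\<lambda>v. r *\<^sub>R L' x u v)) (at x)"
      by (rule has_derivative_transform_within_open[OF has_derivative_scaleR_right[OF L'[OF x]] S x])
        (simp add: linear_cmul[OF linL])
    then show "L' x (r *\<^sub>R u) v = r *\<^sub>R L' x u v"
      using has_derivative_unique[OF L'[OF x]] by metis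
  qed
  have der: "((\<lambda>x. M x (g x)) has_derivative (\<lambda>v. M x (frechet_derivative g (at x) v
      - L' x (M x (g x)) v))) (at x)"
    if x: "x \<in> S" and g: "Ck_on (Suc k) S g" for x g k
  proof (rule has_derivative_solution[OF S x linL _ L'[OF x]])
    show "inj (L x)" by (rule inj_on_inverseI[of _ "M x"]) (rule left_inv[OF x])
    show g': "(g has_derivative frechet_derivative g (at x)) (at x)"
      by (rule Ck_on_SucD(1)[OF g x])
    show "linear (\<lambda>v. M x (frechet_derivative g (at x) v - L' x (M x (g x)) v))"
      using linear_compose[OF linear_compose_sub[OF has_derivative_linear[OF g']
            has_derivative_linear[OF L'[OF x]]] linM[OF x]] unfolding o_def .
  qed (simp_all add: right_inv x)
  show ?thesis using g
  proof (induction k arbitrary: g)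
    case 0
    \<comment> \<open>\<open>der\<close> asks for a differentiable right-hand side, while
      \<open>g\<close> is only continuous here. Constants come first, and \<open>Ck_on_apply\<close>
      passes from them to \<open>g\<close>.\<close>
    have "Ck_on 0 S (\<lambda>x. M x c)" for c
    proof -
      have "((\<lambda>x. M x c) has_derivative (\<lambda>v. M x (frechet_derivative (\<lambda>x. c) (at x) v
          - L' x (M x c) v))) (at x)" if "x \<in> S" for x
        by (rule der[OF that Ck_on_const[OF S]])
      then show ?thesis
        unfolding Ck_on.simps
        using has_derivative_continuous continuous_at_imp_continuous_on by blast
    qed
    from Ck_on_apply[OF S linM this 0] show ?case .
  next
    case (Suc k)
    note h = Suc.IH[OF Ck_on_lower[OF Suc.prems]]
    have L'v: "Ck_on k S (\<lambda>x. L' x w v)" for w v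
      unfolding L'_def by (rule Ck_on_SucD(2)[OF L])
    have "Ck_on k S (\<lambda>x. L' x (M x (g x)) v)" for v
      by (rule Ck_on_apply[OF S linL' L'v h])
    then have "Ck_on k S (\<lambda>x. frechet_derivative g (at x) v + - L' x (M x (g x)) v)" for v
      by (intro Ck_on_add[OF S] Ck_on_SucD(2)[OF Suc.prems]
          Ck_on_linear_compose[OF bounded_linear_minus[OF bounded_linear_ident] S])
    then have "Ck_on k S (\<lambda>x. M x (frechet_derivative g (at x) v - L' x (M x (g x)) v))" for v
      by (intro Suc.IH) simp
    from Ck_on_SucI[OF S der[OF _ Suc.prems] this] show ?case .
  qed
qed

section \<open>Smoothness of inverse functions\<close>

text \<open>Bootstrapping in \<open>G' y = M (G y)\<close>: the inverse matrices \<open>M x\<close>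
  depend smoothly on \<open>x\<close>, so each order of regularity of \<open>G\<close> yields the
  next.\<close>

lemma Ck_on_inverse_function:
  fixes f G :: "'a::euclidean_space \<Rightarrow> 'a"
  assumes S: "open S" and V: "open V" and GV: "G ` V \<subseteq> S" and f: "\<And>k. Ck_on k S f"
    and linM: "\<And>x. x \<in> S \<Longrightarrow> linear (M x)"
    and left_inv: "\<And>x v. x \<in> S \<Longrightarrow> M x (frechet_derivative f (at x) v) = v"
    and right_inv: "\<And>x v. x \<in> S \<Longrightarrow> frechet_derivative f (at x) (M x v) = v"
    and G: "\<And>y. y \<in> V \<Longrightarrow> (G has_derivative M (G y)) (at y)"
  shows "Ck_on k V G"
proof (induction k)
  case 0
  show ?case
    using has_derivative_continuous[OF G] continuous_at_imp_continuous_on by auto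
next
  case (Suc k)
  have "Ck_on k S (\<lambda>x. M x v)" for v
  proof (rule Ck_on_solution[OF S _ linM left_inv right_inv])
    show "linear (frechet_derivative f (at x))" if "x \<in> S" for x
      using has_derivative_linear[OF Ck_on_SucD(1)[OF f that]] .
    show "Ck_on k S (\<lambda>x. frechet_derivative f (at x) v)" for k v
      by (rule Ck_on_SucD(2)[OF f])
  qed (simp_all add: Ck_on_const S)
  note Ck_on_compose[OF V S GV this Suc.IH]
  from Ck_on_SucI[OF V G this] show ?case .
qed

lemma linear_inverse_of_inj:
  fixes L :: "'a::euclidean_space \<Rightarrow> 'a"
  assumes "linear L" "inj L"
  shows "linear (inv L)" "inv L (L v) = v" "L (inv L v) = v"
proof -
  show 1: "L (inv L v) = v" for v
    using surj_f_inv_f linear_injective_imp_surjective[OF assms] by metis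
  show "inv L (L v) = v" by (rule inv_f_f[OF assms(2)])
  show "linear (inv L)"
    by (rule linearI; rule injD[OF assms(2)])
      (simp_all add: 1 linear_add[OF assms(1)] linear_cmul[OF assms(1)])
qed

lemma inverse_function_smooth:
  fixes f :: "'a::euclidean_space \<Rightarrow> 'a"
  assumes S: "open S" and f: "smooth_on S f" and x: "x \<in> S"
    and inj: "\<And>y. y \<in> S \<Longrightarrow> inj (frechet_derivative f (at y))"
  obtains U G where "open U" "U \<subseteq> S" "x \<in> U" "inj_on f U" "open (f ` U)"
    "\<And>y. y \<in> U \<Longrightarrow> G (f y) = y" "smooth_on (f ` U) G"
proof -
  have Ck: "Ck_on k S f" for k using f by (simp add: smooth_on_def)
  note der = Ck_on_SucD(1)[OF Ck]
  have lin: "linear (frechet_derivative f (at y))" if "y \<in> S" for y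
    using has_derivative_linear[OF der[OF that]] .
  define M where "M y = inv (frechet_derivative f (at y))" for y
  note defs = linear_inverse_of_inj[OF lin inj, folded M_def]
  \<comment> \<open>The inverse function theorem wants the derivative as a continuous family of
    bounded linear functions; in finite dimension continuity in each fixed direction is
    enough.\<close>
  define F where "F y = Blinfun (frechet_derivative f (at y))" for y
  have F: "blinfun_apply (F y) = frechet_derivative f (at y)" if "y \<in> S" for y
    unfolding F_def by (rule bounded_linear_Blinfun_apply) (rule has_derivative_bounded_linear[OF der[OF that]])
  have contF: "continuous_on S F"
  proof (rule continuous_at_imp_continuous_on, rule ballI, rule continuous_blinfun_componentwiseI1)
    fix y b assume y: "y \<in> S"
    have "continuous_on S (\<lambda>y. frechet_derivative f (at y) b)"
      using Ck_on_SucD(2)[OF Ck, of 0] by simp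
    then have "continuous_on S (\<lambda>y. blinfun_apply (F y) b)"
      by (rule continuous_on_eq) (simp add: F)
    then show "continuous (at y) (\<lambda>y. blinfun_apply (F y) b)"
      using S y by (simp add: continuous_on_eq_continuous_at)
  qed
  have "Blinfun (M x) o\<^sub>L F x = id_blinfun"
    using defs(1,2)[OF x x]
    by (intro blinfun_eqI) (simp add: F x bounded_linear_Blinfun_apply linear_conv_bounded_linear)
  then obtain U V G g' where U: "open U" "U \<subseteq> S" "x \<in> U" "open V" "homeomorphism U V f G"
    and G: "\<And>y. y \<in> V \<Longrightarrow> (G has_derivative (g' y)) (at y)"
      "\<And>y. y \<in> V \<Longrightarrow> g' y = inv (blinfun_apply (F (G y)))"
    using inverse_function_theorem[OF S _ contF x, of f "Blinfun (M x)"] der F by metis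
  have GV: "G ` V \<subseteq> S" using U(2,5) by (auto simp: homeomorphism_def)
  have "Ck_on k V G" for k
  proof (rule Ck_on_inverse_function[OF S U(4) GV Ck defs])
    show "(G has_derivative M (G y)) (at y)" if "y \<in> V" for y
      using G[OF that] F[of "G y"] GV that unfolding M_def by auto
  qed
  then show thesis
    using that[of U G] U unfolding smooth_on_def homeomorphism_def
    by (metis inj_on_inverseI)
qed

section \<open>Symmetry of second derivatives and differentiation of \<open>df(Y)\<close>\<close>

text \<open>Two mean value theorems: one along \<open>u\<close> for the increment of
  \<open>f\<close> in the direction \<open>v\<close>, then one along \<open>v\<close> for the
  directional derivative of \<open>f\<close> in the direction \<open>u\<close>.\<close>

lemma second_difference_mvt:
  fixes f :: "'a::euclidean_space \<Rightarrow> real"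
  assumes f: "Ck_on 2 S f" and h: "h > 0"
    and sub: "\<And>s t. 0 \<le> s \<Longrightarrow> s \<le> h \<Longrightarrow> 0 \<le> t \<Longrightarrow> t \<le> h \<Longrightarrow> x + s *\<^sub>R u + t *\<^sub>R v \<in> S"
  shows "\<exists>s t. 0 < s \<and> s < h \<and> 0 < t \<and> t < h \<and>
    f (x + h *\<^sub>R u + h *\<^sub>R v) - f (x + h *\<^sub>R u) - f (x + h *\<^sub>R v) + f x =
    h * h * frechet_derivative (\<lambda>y. frechet_derivative f (at y) u) (at (x + s *\<^sub>R u + t *\<^sub>R v)) v"
proof -
  have f2: "Ck_on (Suc (Suc 0)) S f" using f by (simp add: numeral_2_eq_2)
  note d = Ck_on_SucD(1)[OF f2]
  note d2 = Ck_on_SucD(1)[OF Ck_on_SucD(2)[OF f2, of u]]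
  define D where "D y = frechet_derivative f (at y) u" for y
  define D2 where "D2 y = frechet_derivative D (at y) v" for y
  have line: "((\<lambda>s. g (a + s *\<^sub>R w)) has_real_derivative g' w) (at s)"
    if "(g has_derivative g') (at (a + s *\<^sub>R w))" for g :: "'a \<Rightarrow> real" and g' a w s
  proof -
    have "((\<lambda>s. a + s *\<^sub>R w) has_derivative (\<lambda>r. r *\<^sub>R w)) (at s)"
      by (auto intro!: derivative_eq_intros)
    from has_derivative_compose[OF this that]
    have "((\<lambda>s. g (a + s *\<^sub>R w)) has_derivative (\<lambda>r. r * g' w)) (at s)"
      using linear_cmul[OF has_derivative_linear[OF that]] by simp
    then show ?thesis by (simp add: has_field_derivative_def mult_commute_abs)
  qed
  have "\<exists>s>0. s < h \<and> (f (x + h *\<^sub>R v + h *\<^sub>R u) - f (x + h *\<^sub>R u)) - (f (x + h *\<^sub>R v + 0 *\<^sub>R u) - f (x + 0 *\<^sub>R u))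
     = (h - 0) * (D (x + h *\<^sub>R v + s *\<^sub>R u) - D (x + s *\<^sub>R u))"
  proof (rule MVT2[OF h])
    fix s assume s: "0 \<le> s" "s \<le> h"
    have "x + h *\<^sub>R v + s *\<^sub>R u \<in> S" "x + s *\<^sub>R u \<in> S"
      using sub[of s h] sub[of s 0] s h by (simp_all add: algebra_simps)
    then show "((\<lambda>s. f (x + h *\<^sub>R v + s *\<^sub>R u) - f (x + s *\<^sub>R u)) has_real_derivative
      (D (x + h *\<^sub>R v + s *\<^sub>R u) - D (x + s *\<^sub>R u))) (at s)"
      unfolding D_def by (intro DERIV_diff line d)
  qed
  then obtain s where s: "0 < s" "s < h" and eq1:
    "f (x + h *\<^sub>R u + h *\<^sub>R v) - f (x + h *\<^sub>R u) - f (x + h *\<^sub>R v) + f x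
     = h * (D (x + s *\<^sub>R u + h *\<^sub>R v) - D (x + s *\<^sub>R u + 0 *\<^sub>R v))"
    by (auto simp: algebra_simps)
  have "\<exists>t>0. t < h \<and> D (x + s *\<^sub>R u + h *\<^sub>R v) - D (x + s *\<^sub>R u + 0 *\<^sub>R v)
     = (h - 0) * D2 (x + s *\<^sub>R u + t *\<^sub>R v)"
  proof (rule MVT2[OF h])
    fix t assume "0 \<le> t" "t \<le> h"
    then have "x + s *\<^sub>R u + t *\<^sub>R v \<in> S" using sub s by simp
    then show "((\<lambda>t. D (x + s *\<^sub>R u + t *\<^sub>R v)) has_real_derivative D2 (x + s *\<^sub>R u + t *\<^sub>R v)) (at t)"
      unfolding D2_def D_def by (intro line d2)
  qed
  then obtain t where t: "0 < t" "t < h" and eq2: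
    "D (x + s *\<^sub>R u + h *\<^sub>R v) - D (x + s *\<^sub>R u + 0 *\<^sub>R v) = h * D2 (x + s *\<^sub>R u + t *\<^sub>R v)" by auto
  show ?thesis
    using s t eq1[unfolded eq2] unfolding D2_def D_def by (auto simp: mult.assoc)
qed

text \<open>The second difference over a parallelogram is symmetric in \<open>u\<close> and
  \<open>v\<close>, so the two mixed derivatives agree at two points close to \<open>x\<close>;
  continuity does the rest.\<close>

lemma frechet_derivative_symmetric_real:
  fixes f :: "'a::euclidean_space \<Rightarrow> real"
  assumes S: "open S" and f: "Ck_on 2 S f" and x: "x \<in> S"
  shows "frechet_derivative (\<lambda>y. frechet_derivative f (at y) u) (at x) v =
         frechet_derivative (\<lambda>y. frechet_derivative f (at y) v) (at x) u"
proof -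
  define D where "D u v y = frechet_derivative (\<lambda>y. frechet_derivative f (at y) u) (at y) v" for u v y
  have cont: "isCont (D u v) x" for u v
  proof -
    have "Ck_on (Suc (Suc 0)) S f" using f by (simp add: numeral_2_eq_2)
    then have "continuous_on S (D u v)" unfolding D_def by simp
    then show ?thesis using S x continuous_on_eq_continuous_at by blast
  qed
  have "\<bar>D u v x - D v u x\<bar> \<le> e" if e: "e > 0" for e
  proof -
    obtain r where r: "r > 0" "ball x r \<subseteq> S"
      "\<And>y. dist y x < r \<Longrightarrow> dist (D u v y) (D u v x) < e/2"
      "\<And>y. dist y x < r \<Longrightarrow> dist (D v u y) (D v u x) < e/2"
    proof -
      obtain r1 where "r1 > 0" "ball x r1 \<subseteq> S" using S x openE by blast
      moreover obtain r2 where "r2 > 0" "\<And>y. dist y x < r2 \<Longrightarrow> dist (D u v y) (D u v x) < e/2"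
        using cont[of u v, unfolded continuous_at_eps_delta, rule_format, of "e/2"] e by auto
      moreover obtain r3 where "r3 > 0" "\<And>y. dist y x < r3 \<Longrightarrow> dist (D v u y) (D v u x) < e/2"
        using cont[of v u, unfolded continuous_at_eps_delta, rule_format, of "e/2"] e by auto
      moreover have "ball x (min r1 (min r2 r3)) \<subseteq> ball x r1" by auto
      ultimately show thesis using that[of "min r1 (min r2 r3)"] by force
    qed
    \<comment> \<open>With this side length the parallelogram stays within \<open>r / 2\<close> of
      \<open>x\<close>; the summand 1 keeps the denominator positive when
      \<open>u = v = 0\<close>.\<close>
    define h where "h = r / 2 / (norm u + norm v + 1)"
    have nuv: "norm u + norm v + 1 > 0" by (simp add: add_nonneg_pos)
    have h: "h > 0" unfolding h_def using r(1) nuv by simp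
    have near: "dist (x + s *\<^sub>R u + t *\<^sub>R v) x < r" if "0 \<le> s" "s \<le> h" "0 \<le> t" "t \<le> h" for s t
    proof -
      have "norm (s *\<^sub>R u + t *\<^sub>R v) \<le> s * norm u + t * norm v"
        using norm_triangle_ineq[of "s *\<^sub>R u" "t *\<^sub>R v"] that by simp
      also have "\<dots> \<le> h * norm u + h * norm v"
        using that by (intro add_mono mult_right_mono) auto
      also have "\<dots> \<le> h * (norm u + norm v + 1)" using h by (simp add: algebra_simps)
      also have "\<dots> = r / 2"
        unfolding h_def using nuv by (intro nonzero_eq_divide_eq[THEN iffD1]) auto
      also have "\<dots> < r" using r(1) by simp
      finally show ?thesis by (simp add: dist_norm algebra_simps)
    qed
    have sub: "x + s *\<^sub>R u + t *\<^sub>R v \<in> S" if "0 \<le> s" "s \<le> h" "0 \<le> t" "t \<le> h" for s t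
      using near[OF that] r(2) by (auto simp: dist_commute)
    obtain s t where st: "0 < s" "s < h" "0 < t" "t < h"
      "f (x + h *\<^sub>R u + h *\<^sub>R v) - f (x + h *\<^sub>R u) - f (x + h *\<^sub>R v) + f x
       = h * h * D u v (x + s *\<^sub>R u + t *\<^sub>R v)"
      using second_difference_mvt[OF f h sub] unfolding D_def by blast
    have sub': "x + s *\<^sub>R v + t *\<^sub>R u \<in> S" if "0 \<le> s" "s \<le> h" "0 \<le> t" "t \<le> h" for s t
      using sub[of t s] that by (simp add: algebra_simps)
    obtain s' t' where st': "0 < s'" "s' < h" "0 < t'" "t' < h"
      "f (x + h *\<^sub>R v + h *\<^sub>R u) - f (x + h *\<^sub>R v) - f (x + h *\<^sub>R u) + f x
       = h * h * D v u (x + s' *\<^sub>R v + t' *\<^sub>R u)"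
      using second_difference_mvt[OF f h sub'] unfolding D_def by blast
    have "h * h * D u v (x + s *\<^sub>R u + t *\<^sub>R v) = h * h * D v u (x + t' *\<^sub>R u + s' *\<^sub>R v)"
      using st(5) st'(5) by (simp add: algebra_simps)
    then have "D u v (x + s *\<^sub>R u + t *\<^sub>R v) = D v u (x + t' *\<^sub>R u + s' *\<^sub>R v)" using h by simp
    moreover have "\<bar>D u v (x + s *\<^sub>R u + t *\<^sub>R v) - D u v x\<bar> < e / 2"
      using r(3)[OF near[of s t]] st by (simp add: dist_real_def)
    moreover have "\<bar>D v u (x + t' *\<^sub>R u + s' *\<^sub>R v) - D v u x\<bar> < e / 2"
      using r(4)[OF near[of t' s']] st' by (simp add: dist_real_def)
    ultimately show ?thesis by linarith
  qed
  then have "\<bar>D u v x - D v u x\<bar> \<le> 0" by (rule field_le_epsilon) simp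
  then show ?thesis unfolding D_def by simp
qed

lemma frechet_derivative_linear_compose:
  assumes "bounded_linear L" "f differentiable (at x)"
  shows "frechet_derivative (\<lambda>y. L (f y)) (at x) v = L (frechet_derivative f (at x) v)"
  using bounded_linear.has_derivative[OF assms(1)] assms(2)[unfolded frechet_derivative_works]
    frechet_derivative_at by metis

lemma frechet_derivative_symmetric:
  fixes f :: "'a::euclidean_space \<Rightarrow> 'b::euclidean_space"
  assumes S: "open S" and f: "Ck_on 2 S f" and x: "x \<in> S"
  shows "frechet_derivative (\<lambda>y. frechet_derivative f (at y) u) (at x) v =
         frechet_derivative (\<lambda>y. frechet_derivative f (at y) v) (at x) u"
proof (rule euclidean_eqI)
  fix b :: 'b assume "b \<in> Basis"
  have f2: "Ck_on (Suc (Suc 0)) S f" using f by (simp add: numeral_2_eq_2)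
  have d: "f differentiable (at y)" if "y \<in> S" for y using f2 that by simp
  have d2: "(\<lambda>y. frechet_derivative f (at y) w) differentiable (at x)" for w
    using f2 x by simp
  have *: "frechet_derivative (\<lambda>y. frechet_derivative f (at y) u) (at x) v \<bullet> b =
     frechet_derivative (\<lambda>y. frechet_derivative (\<lambda>y. f y \<bullet> b) (at y) u) (at x) v" for u v
  proof -
    have "frechet_derivative (\<lambda>y. frechet_derivative f (at y) u) (at x) v \<bullet> b =
      frechet_derivative (\<lambda>y. frechet_derivative f (at y) u \<bullet> b) (at x) v"
      by (rule frechet_derivative_linear_compose[OF bounded_linear_inner_left d2, symmetric])
    also have "frechet_derivative (\<lambda>y. frechet_derivative f (at y) u \<bullet> b) (at x) =
      frechet_derivative (\<lambda>y. frechet_derivative (\<lambda>y. f y \<bullet> b) (at y) u) (at x)"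
    proof (rule frechet_derivative_transform_within_open[OF _ S x])
      show "(\<lambda>y. frechet_derivative f (at y) u \<bullet> b) differentiable (at x)"
        using bounded_linear.has_derivative[OF bounded_linear_inner_left d2[unfolded frechet_derivative_works]]
        unfolding differentiable_def by blast
      show "frechet_derivative f (at y) u \<bullet> b = frechet_derivative (\<lambda>y. f y \<bullet> b) (at y) u"
        if "y \<in> S" for y
        by (rule frechet_derivative_linear_compose[OF bounded_linear_inner_left d[OF that], symmetric])
    qed
    finally show ?thesis .
  qed
  show "frechet_derivative (\<lambda>y. frechet_derivative f (at y) u) (at x) v \<bullet> b =
         frechet_derivative (\<lambda>y. frechet_derivative f (at y) v) (at x) u \<bullet> b"
    unfolding *
    by (rule frechet_derivative_symmetric_real[OF S Ck_on_linear_compose[OF bounded_linear_inner_left S f] x])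
qed

lemma has_derivative_frechet_apply:
  fixes f :: "'a::euclidean_space \<Rightarrow> 'b::euclidean_space" and g :: "'a \<Rightarrow> 'a"
  assumes S: "open S" and f: "Ck_on 2 S f" and x: "x \<in> S" and g: "(g has_derivative g') (at x)"
  shows "((\<lambda>y. frechet_derivative f (at y) (g y)) has_derivative
    (\<lambda>v. frechet_derivative (\<lambda>y. frechet_derivative f (at y) v) (at x) (g x)
       + frechet_derivative f (at x) (g' v))) (at x)"
proof -
  define D where "D u v = frechet_derivative (\<lambda>y. frechet_derivative f (at y) u) (at x) v" for u v
  have f2: "Ck_on (Suc (Suc 0)) S f" using f by (simp add: numeral_2_eq_2)
  have lin: "linear (frechet_derivative f (at y))" if "y \<in> S" for y
    using has_derivative_linear[OF Ck_on_SucD(1)[OF f2 that]] .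
  have D: "((\<lambda>y. frechet_derivative f (at y) u) has_derivative D u) (at x)" for u
    using Ck_on_SucD(1)[OF Ck_on_SucD(2)[OF f2] x] unfolding D_def[abs_def] .
  have "((\<lambda>y. \<Sum>b\<in>Basis. (g y \<bullet> b) *\<^sub>R frechet_derivative f (at y) b) has_derivative
    (\<lambda>v. \<Sum>b\<in>Basis. (g x \<bullet> b) *\<^sub>R D b v + (g' v \<bullet> b) *\<^sub>R frechet_derivative f (at x) b)) (at x)"
    by (intro has_derivative_sum has_derivative_scaleR has_derivative_inner_left g D)
  moreover have "(\<Sum>b\<in>Basis. (g x \<bullet> b) *\<^sub>R D b v + (g' v \<bullet> b) *\<^sub>R frechet_derivative f (at x) b)
    = D v (g x) + frechet_derivative f (at x) (g' v)" for v
  proof -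
    \<comment> \<open>Symmetry moves the summation index into the slot of the outer derivative,
      where linearity is automatic, so the sum collapses to \<open>D v (g x)\<close>.\<close>
    have "D b v = D v b" for b
      unfolding D_def by (rule frechet_derivative_symmetric[OF S f x])
    then show ?thesis
      using linear_basis_expansion[OF has_derivative_linear[OF D], of v "g x"]
        linear_basis_expansion[OF lin[OF x], of "g' v"]
      by (simp add: sum.distrib)
  qed
  ultimately have "((\<lambda>y. \<Sum>b\<in>Basis. (g y \<bullet> b) *\<^sub>R frechet_derivative f (at y) b) has_derivative
    (\<lambda>v. D v (g x) + frechet_derivative f (at x) (g' v))) (at x)" by simp
  then show ?thesis unfolding D_def
    by (rule has_derivative_transform_within_open[OF _ S x])
      (rule linear_basis_expansion[OF lin, symmetric])
qed

section \<open>Rules for maps that are smooth of every order\<close>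

lemma smooth_on_cong:
  "open S \<Longrightarrow> (\<And>x. x \<in> S \<Longrightarrow> f x = g x) \<Longrightarrow> smooth_on S f \<Longrightarrow> smooth_on S g"
  unfolding smooth_on_def using Ck_on_cong by blast

lemma smooth_on_subset: "smooth_on S f \<Longrightarrow> T \<subseteq> S \<Longrightarrow> smooth_on T f"
  unfolding smooth_on_def using Ck_on_subset by blast

lemma smooth_on_has_derivative:
  "smooth_on S f \<Longrightarrow> x \<in> S \<Longrightarrow> (f has_derivative frechet_derivative f (at x)) (at x)"
  unfolding smooth_on_def using Ck_on_SucD(1) by blast

lemma smooth_on_linear_compose:
  "bounded_linear L \<Longrightarrow> open S \<Longrightarrow> smooth_on S f \<Longrightarrow> smooth_on S (\<lambda>x. L (f x))"
  unfolding smooth_on_def by (simp add: Ck_on_linear_compose)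

lemma smooth_on_linear:
  assumes "bounded_linear L" "open S"
  shows "smooth_on S L"
  unfolding smooth_on_def
proof
  fix k
  have "Ck_on (Suc k) S L"
    by (rule Ck_on_SucI[OF assms(2) bounded_linear_imp_has_derivative[OF assms(1)] Ck_on_const[OF assms(2)]])
  then show "Ck_on k S L" by (rule Ck_on_lower)
qed

lemma smooth_on_add:
  "open S \<Longrightarrow> smooth_on S f \<Longrightarrow> smooth_on S g \<Longrightarrow> smooth_on S (\<lambda>x. f x + g x)"
  unfolding smooth_on_def by (simp add: Ck_on_add)

lemma smooth_on_bilinear:
  "bounded_bilinear b \<Longrightarrow> open S \<Longrightarrow> smooth_on S f \<Longrightarrow> smooth_on S g \<Longrightarrow>
    smooth_on S (\<lambda>x. b (f x) (g x))"
  unfolding smooth_on_def by (simp add: Ck_on_bilinear)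

lemma smooth_on_compose:
  assumes "open S" "open T" "g ` S \<subseteq> T" "smooth_on T f" "smooth_on S g"
  shows "smooth_on S (\<lambda>x. f (g x))"
  using assms(4,5) Ck_on_compose[OF assms(1-3)] unfolding smooth_on_def by blast

lemma smooth_on_frechet_apply:
  fixes f :: "'a::euclidean_space \<Rightarrow> 'b::real_normed_vector"
  assumes S: "open S" and f: "smooth_on S f" and g: "smooth_on S g"
  shows "smooth_on S (\<lambda>x. frechet_derivative f (at x) (g x))"
  unfolding smooth_on_def
proof
  fix k
  have f': "Ck_on (Suc k) S f" and g': "Ck_on k S g" using f g by (auto simp: smooth_on_def simp del: Ck_on.simps)
  show "Ck_on k S (\<lambda>x. frechet_derivative f (at x) (g x))"
    by (rule Ck_on_apply[OF S has_derivative_linear[OF Ck_on_SucD(1)[OF f']] Ck_on_SucD(2)[OF f'] g'])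
qed

text \<open>Injectivity identifies the pointwise solution \<open>h\<close> with
  \<open>M x (g x)\<close>, where \<open>M x\<close> is the inverse matrix. This will give the
  smoothness of \<open>nabla X Y\<close> in charts.\<close>

lemma smooth_on_solution:
  fixes f :: "'a::euclidean_space \<Rightarrow> 'a"
  assumes S: "open S" and f: "smooth_on S f" and g: "smooth_on S g"
    and inj: "\<And>x. x \<in> S \<Longrightarrow> inj (frechet_derivative f (at x))"
    and h: "\<And>x. x \<in> S \<Longrightarrow> frechet_derivative f (at x) (h x) = g x"
  shows "smooth_on S h"
  unfolding smooth_on_def
proof
  fix k
  have f': "Ck_on k S f" for k using f by (simp add: smooth_on_def)
  have lin: "linear (frechet_derivative f (at x))" if "x \<in> S" for x
    using has_derivative_linear[OF Ck_on_SucD(1)[OF f' that]] .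
  define M where "M x = inv (frechet_derivative f (at x))" for x
  note defs = linear_inverse_of_inj[OF lin inj, folded M_def]
  have "Ck_on k S (\<lambda>x. M x (g x))"
    by (rule Ck_on_solution[OF S lin defs Ck_on_SucD(2)[OF f']])
      (use g in \<open>simp_all add: smooth_on_def\<close>)
  then show "Ck_on k S h"
    by (rule Ck_on_cong[OF S, rotated]) (use defs(2) h in metis)
qed

section \<open>Differentials and vector fields on a complex manifold\<close>

abbreviation chart_inv :: "('m, 'n::finite) chart \<Rightarrow> complex ^ 'n \<Rightarrow> 'm" where
  "chart_inv c \<equiv> inv_into (fst c) (snd c)"

locale complex_mfd =
  fixes A :: "('m::{t2_space, second_countable_topology}, 'n::finite) chart set"
  assumes mfd: "complex_manifold A"
begin

lemma chart_ex: obtains c where "c \<in> A" "p \<in> fst c"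
  using mfd unfolding complex_manifold_def by blast

lemma chart_homeomorphism:
  "c \<in> A \<Longrightarrow> homeomorphism (fst c) (snd c ` fst c) (snd c) (chart_inv c)"
  and open_chart: "c \<in> A \<Longrightarrow> open (fst c)"
  and open_chart_image: "c \<in> A \<Longrightarrow> open (snd c ` fst c)"
  using mfd unfolding complex_manifold_def is_chart_def by auto

lemma chart_inv_left [simp]: "c \<in> A \<Longrightarrow> p \<in> fst c \<Longrightarrow> chart_inv c (snd c p) = p"
  using chart_homeomorphism unfolding homeomorphism_def by blast

lemma chart_inv_mem: "c \<in> A \<Longrightarrow> x \<in> snd c ` fst c \<Longrightarrow> chart_inv c x \<in> fst c"
  by (rule inv_into_into)

lemma chart_inv_right: "c \<in> A \<Longrightarrow> x \<in> snd c ` fst c \<Longrightarrow> snd c (chart_inv c x) = x"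
  by (rule f_inv_into_f)

lemma open_chart_subimage:
  assumes "c \<in> A" "open U" "U \<subseteq> fst c"
  shows "open (snd c ` U)"
proof -
  have "openin (top_of_set (snd c ` fst c)) (snd c ` U)"
    by (rule homeomorphism_imp_open_map[OF chart_homeomorphism[OF assms(1)]])
      (use assms in \<open>simp add: open_subset\<close>)
  then show ?thesis using open_chart_image[OF assms(1)] openin_open_trans by blast
qed

lemma transition_smooth:
  "c \<in> A \<Longrightarrow> c' \<in> A \<Longrightarrow> smooth_on (snd c ` (fst c \<inter> fst c')) (snd c' \<circ> chart_inv c)"
  and transition_linear: "c \<in> A \<Longrightarrow> c' \<in> A \<Longrightarrow> p \<in> fst c \<Longrightarrow> p \<in> fst c' \<Longrightarrow>
    frechet_derivative (snd c' \<circ> chart_inv c) (at (snd c p)) (\<i> *s v)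
    = \<i> *s frechet_derivative (snd c' \<circ> chart_inv c) (at (snd c p)) v"
  using mfd unfolding complex_manifold_def holo_on_def by blast+

lemma transition_has_derivative:
  assumes "c \<in> A" "c' \<in> A" "p \<in> fst c" "p \<in> fst c'"
  shows "((snd c' \<circ> chart_inv c) has_derivative
    frechet_derivative (snd c' \<circ> chart_inv c) (at (snd c p))) (at (snd c p))"
  by (rule smooth_on_has_derivative[OF transition_smooth]) (use assms in auto)

section \<open>Change of chart, the differential and tangent vectors\<close>

lemma chart_change:
  fixes f :: "'m \<Rightarrow> 'b::real_normed_vector"
  assumes c: "c \<in> A" "c' \<in> A" "p \<in> fst c" "p \<in> fst c'"
    and f: "((f \<circ> chart_inv c) has_derivative f') (at (snd c p))"
  shows "((f \<circ> chart_inv c') has_derivative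
    (\<lambda>v. f' (frechet_derivative (snd c \<circ> chart_inv c') (at (snd c' p)) v))) (at (snd c' p))"
proof -
  let ?h = "snd c \<circ> chart_inv c'"
  let ?O = "snd c' ` (fst c' \<inter> fst c)"
  have hp: "?h (snd c' p) = snd c p" using c by simp
  have "(((f \<circ> chart_inv c) \<circ> ?h) has_derivative
    (f' \<circ> frechet_derivative ?h (at (snd c' p)))) (at (snd c' p))"
    by (rule diff_chain_at[OF transition_has_derivative]) (use c f hp in auto)
  then have "((f \<circ> chart_inv c') has_derivative
    (f' \<circ> frechet_derivative ?h (at (snd c' p)))) (at (snd c' p))"
  proof (rule has_derivative_transform_within_open)
    show "open ?O" using c by (intro open_chart_subimage open_Int open_chart) auto
    show "snd c' p \<in> ?O" using c by simp
    show "((f \<circ> chart_inv c) \<circ> ?h) x = (f \<circ> chart_inv c') x" if "x \<in> ?O" for x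
      using that c by auto
  qed
  then show ?thesis by (simp add: o_def)
qed

text \<open>\<open>diff\<close> looks at one selected chart; the transition derivative produced by
  changing the chart of \<open>f\<close> is absorbed by the transformation law of
  \<open>v\<close>.\<close>

lemma diff_chart:
  fixes f :: "'m \<Rightarrow> 'b::real_normed_vector"
  assumes c: "c \<in> A" "p \<in> fst c" and v: "v \<in> tangent_space A p"
    and f: "(f \<circ> chart_inv c) differentiable (at (snd c p))"
  shows "diff A f p v = frechet_derivative (f \<circ> chart_inv c) (at (snd c p)) (v c)"
proof -
  define c0 where "c0 = (SOME c. c \<in> A \<and> p \<in> fst c)"
  have c0: "c0 \<in> A" "p \<in> fst c0"
    using someI[of "\<lambda>c. c \<in> A \<and> p \<in> fst c" c] c unfolding c0_def by blast+
  have "v c = frechet_derivative (snd c \<circ> chart_inv c0) (at (snd c0 p)) (v c0)"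
    using v c c0 unfolding tangent_space_def by blast
  moreover have "frechet_derivative (f \<circ> chart_inv c0) (at (snd c0 p)) =
    (\<lambda>v. frechet_derivative (f \<circ> chart_inv c) (at (snd c p))
      (frechet_derivative (snd c \<circ> chart_inv c0) (at (snd c0 p)) v))"
    by (rule frechet_derivative_at[symmetric])
      (rule chart_change[OF c(1) c0(1) c(2) c0(2) f[unfolded frechet_derivative_works]])
  ultimately show ?thesis unfolding diff_def by (simp add: c0_def[symmetric] Let_def)
qed

text \<open>The inverse of the isomorphism from the tangent space to \<open>complex ^ 'n\<close>
  that reads off the component in the chart \<open>c\<close>; it is the source of tangent vectors
  with prescribed components.\<close>

definition vec_of :: "('m, 'n) chart \<Rightarrow> 'm \<Rightarrow> complex ^ 'n \<Rightarrow> ('m, 'n) tvec" where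
  "vec_of c p \<xi> = (\<lambda>c'. if c' \<in> A \<and> p \<in> fst c'
     then frechet_derivative (snd c' \<circ> chart_inv c) (at (snd c p)) \<xi> else 0)"

text \<open>This is the cocycle rule for transition derivatives, obtained from
  \<open>chart_change\<close> with a coordinate map in the role of \<open>f\<close>.\<close>

lemma vec_of_tangent:
  assumes c: "c \<in> A" "p \<in> fst c"
  shows "vec_of c p \<xi> \<in> tangent_space A p"
proof -
  have *: "frechet_derivative (snd c2 \<circ> chart_inv c) (at (snd c p)) =
    (\<lambda>v. frechet_derivative (snd c2 \<circ> chart_inv c1) (at (snd c1 p))
      (frechet_derivative (snd c1 \<circ> chart_inv c) (at (snd c p)) v))"
    if "c1 \<in> A" "c2 \<in> A" "p \<in> fst c1" "p \<in> fst c2" for c1 c2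
    by (rule frechet_derivative_at[symmetric])
      (rule chart_change[OF that(1) c(1) that(3) c(2) transition_has_derivative[OF that]])
  have "vec_of c p \<xi> c2 = frechet_derivative (snd c2 \<circ> chart_inv c1) (at (snd c1 p)) (vec_of c p \<xi> c1)"
    if "c1 \<in> A" "c2 \<in> A" "p \<in> fst c1" "p \<in> fst c2" for c1 c2
    using *[OF that, THEN fun_cong, of \<xi>] that by (simp add: vec_of_def)
  moreover have "vec_of c p \<xi> c' = 0" if "\<not> (c' \<in> A \<and> p \<in> fst c')" for c'
    using that by (auto simp: vec_of_def)
  ultimately show ?thesis unfolding tangent_space_def by blast
qed

lemma vec_of_self:
  assumes c: "c \<in> A" "p \<in> fst c"
  shows "vec_of c p \<xi> c = \<xi>"
proof -
  have "((\<lambda>x. x) has_derivative (\<lambda>v. v)) (at (snd c p))" by simp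
  then have "((snd c \<circ> chart_inv c) has_derivative (\<lambda>v. v)) (at (snd c p))"
    by (rule has_derivative_transform_within_open[OF _ open_chart_image[OF c(1)]])
      (use c chart_inv_right in auto)
  from frechet_derivative_at[OF this] show ?thesis using c unfolding vec_of_def by metis
qed

lemma tangent_transition:
  assumes "v \<in> tangent_space A p" "c \<in> A" "c' \<in> A" "p \<in> fst c" "p \<in> fst c'"
  shows "v c' = frechet_derivative (snd c' \<circ> chart_inv c) (at (snd c p)) (v c)"
  using assms unfolding tangent_space_def by blast

lemma tangent_outside: "v \<in> tangent_space A p \<Longrightarrow> \<not> (c \<in> A \<and> p \<in> fst c) \<Longrightarrow> v c = 0"
  unfolding tangent_space_def by blast

lemma tangent_linear:
  assumes "c \<in> A" "c' \<in> A" "p \<in> fst c" "p \<in> fst c'"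
  shows "linear (frechet_derivative (snd c' \<circ> chart_inv c) (at (snd c p)))"
  using has_derivative_linear[OF transition_has_derivative[OF assms]] .

text \<open>A common principle for sums, differences, real multiples and \<open>J\<close>;
  \<open>g 0 0 = 0\<close> serves the charts that do not contain \<open>p\<close>. For
  \<open>J\<close> the compatibility is the Cauchy-Riemann condition on the atlas.\<close>

lemma tangent_pointwise:
  assumes uv: "u \<in> tangent_space A p" "v \<in> tangent_space A p" and "g 0 0 = 0"
    and g: "\<And>c c' a b. c \<in> A \<Longrightarrow> c' \<in> A \<Longrightarrow> p \<in> fst c \<Longrightarrow> p \<in> fst c' \<Longrightarrow>
      g (frechet_derivative (snd c' \<circ> chart_inv c) (at (snd c p)) a)
        (frechet_derivative (snd c' \<circ> chart_inv c) (at (snd c p)) b)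
      = frechet_derivative (snd c' \<circ> chart_inv c) (at (snd c p)) (g a b)"
  shows "(\<lambda>c. g (u c) (v c)) \<in> tangent_space A p"
  unfolding tangent_space_def
proof (intro CollectI conjI ballI allI impI)
  fix c c' assume c: "c \<in> A" "c' \<in> A" "p \<in> fst c" "p \<in> fst c'"
  show "g (u c') (v c') = frechet_derivative (snd c' \<circ> chart_inv c) (at (snd c p)) (g (u c) (v c))"
    unfolding tangent_transition[OF uv(1) c] tangent_transition[OF uv(2) c] by (rule g[OF c])
next
  fix c assume "\<not> (c \<in> A \<and> p \<in> fst c)"
  then show "g (u c) (v c) = 0" using tangent_outside uv assms(3) by metis
qed

lemma tangent_add: "u \<in> tangent_space A p \<Longrightarrow> v \<in> tangent_space A p \<Longrightarrow> u + v \<in> tangent_space A p"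
  using tangent_pointwise[of u p v "(+)"] by (simp add: linear_add[OF tangent_linear] plus_fun_def)

lemma tangent_diff: "u \<in> tangent_space A p \<Longrightarrow> v \<in> tangent_space A p \<Longrightarrow> u - v \<in> tangent_space A p"
  using tangent_pointwise[of u p v "(-)"] by (simp add: linear_diff[OF tangent_linear] fun_diff_def)

lemma tangent_scale: "u \<in> tangent_space A p \<Longrightarrow> tscale r u \<in> tangent_space A p"
  using tangent_pointwise[of u p u "\<lambda>a b. r *\<^sub>R a"]
  by (simp add: linear_cmul[OF tangent_linear] tscale_def)

lemma tangent_J: "u \<in> tangent_space A p \<Longrightarrow> J u \<in> tangent_space A p"
  using tangent_pointwise[of u p u "\<lambda>a b. \<i> *s a"] by (simp add: transition_linear J_def)

lemma smooth_chart:
  fixes f :: "'m \<Rightarrow> 'b::real_normed_vector"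
  shows "smooth_map_on A UNIV f \<Longrightarrow> c \<in> A \<Longrightarrow> smooth_on (snd c ` fst c) (f \<circ> chart_inv c)"
  unfolding smooth_map_on_def by force

lemma smooth_mapI:
  fixes f :: "'m \<Rightarrow> 'b::real_normed_vector"
  shows "(\<And>c. c \<in> A \<Longrightarrow> smooth_on (snd c ` fst c) (f \<circ> chart_inv c)) \<Longrightarrow> smooth_map_on A UNIV f"
  unfolding smooth_map_on_def by simp

lemma smooth_has_derivative:
  fixes f :: "'m \<Rightarrow> 'b::real_normed_vector"
  assumes "smooth_map_on A UNIV f" "c \<in> A" "p \<in> fst c"
  shows "((f \<circ> chart_inv c) has_derivative
    frechet_derivative (f \<circ> chart_inv c) (at (snd c p))) (at (snd c p))"
  by (rule smooth_on_has_derivative[OF smooth_chart]) (use assms in auto)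

lemma diff_smooth_chart:
  fixes f :: "'m \<Rightarrow> 'b::real_normed_vector"
  assumes "smooth_map_on A UNIV f" "c \<in> A" "p \<in> fst c" "v \<in> tangent_space A p"
  shows "diff A f p v = frechet_derivative (f \<circ> chart_inv c) (at (snd c p)) (v c)"
  using diff_chart[OF assms(2-4)] smooth_has_derivative[OF assms(1-3)] differentiable_def by blast

lemma diff_eqI:
  fixes f :: "'m \<Rightarrow> 'b::real_normed_vector"
  assumes "c \<in> A" "p \<in> fst c" "v \<in> tangent_space A p"
    and "((f \<circ> chart_inv c) has_derivative f') (at (snd c p))"
  shows "diff A f p v = f' (v c)"
  using diff_chart[OF assms(1-3)] frechet_derivative_at[OF assms(4)] assms(4)
  unfolding differentiable_def by metis

lemma diff_add:
  fixes f :: "'m \<Rightarrow> 'b::real_normed_vector"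
  assumes "smooth_map_on A UNIV f" "u \<in> tangent_space A p" "v \<in> tangent_space A p"
  shows "diff A f p (u + v) = diff A f p u + diff A f p v"
  by (rule chart_ex[of p])
    (use assms in \<open>simp add: diff_smooth_chart tangent_add
      linear_add[OF has_derivative_linear[OF smooth_has_derivative]]\<close>)

lemma diff_diff:
  fixes f :: "'m \<Rightarrow> 'b::real_normed_vector"
  assumes "smooth_map_on A UNIV f" "u \<in> tangent_space A p" "v \<in> tangent_space A p"
  shows "diff A f p (u - v) = diff A f p u - diff A f p v"
  by (rule chart_ex[of p])
    (use assms in \<open>simp add: diff_smooth_chart tangent_diff
      linear_diff[OF has_derivative_linear[OF smooth_has_derivative]]\<close>)

lemma diff_scale:
  fixes f :: "'m \<Rightarrow> 'b::real_normed_vector"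
  assumes "smooth_map_on A UNIV f" "u \<in> tangent_space A p"
  shows "diff A f p (tscale r u) = r *\<^sub>R diff A f p u"
  by (rule chart_ex[of p])
    (use assms in \<open>simp add: diff_smooth_chart tangent_scale tscale_def[of r u, THEN fun_cong]
      linear_cmul[OF has_derivative_linear[OF smooth_has_derivative]]\<close>)

text \<open>Both sides are computed in the same selected chart, so the rule rewrites under binders
  for arbitrary \<open>v\<close>.\<close>

lemma diff_linear_compose:
  fixes f :: "'m \<Rightarrow> 'b::real_normed_vector"
  assumes "bounded_linear L" "smooth_map_on A UNIV f"
  shows "diff A (\<lambda>q. L (f q)) p v = L (diff A f p v)"
proof -
  define c where "c = (SOME c. c \<in> A \<and> p \<in> fst c)"
  have c: "c \<in> A" "p \<in> fst c"
    using chart_ex[of p] someI[of "\<lambda>c. c \<in> A \<and> p \<in> fst c"] unfolding c_def by metis+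
  have "frechet_derivative (\<lambda>x. L ((f \<circ> chart_inv c) x)) (at (snd c p)) (v c)
    = L (frechet_derivative (f \<circ> chart_inv c) (at (snd c p)) (v c))"
    using frechet_derivative_linear_compose[OF assms(1) differentiableI[OF smooth_has_derivative[OF assms(2) c]]] .
  then show ?thesis unfolding diff_def c_def[symmetric] Let_def by (simp add: o_def)
qed

lemma diff_bilinear:
  fixes f :: "'m \<Rightarrow> 'b::real_normed_vector" and g :: "'m \<Rightarrow> 'c::real_normed_vector"
  assumes B: "bounded_bilinear B" and f: "smooth_map_on A UNIV f" and g: "smooth_map_on A UNIV g"
    and v: "v \<in> tangent_space A p"
  shows "diff A (\<lambda>q. B (f q) (g q)) p v = B (f p) (diff A g p v) + B (diff A f p v) (g p)"
proof -
  obtain c where c: "c \<in> A" "p \<in> fst c" by (rule chart_ex)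
  have "(((\<lambda>q. B (f q) (g q)) \<circ> chart_inv c) has_derivative
    (\<lambda>v. B (f p) (frechet_derivative (g \<circ> chart_inv c) (at (snd c p)) v)
       + B (frechet_derivative (f \<circ> chart_inv c) (at (snd c p)) v) (g p))) (at (snd c p))"
    using bounded_bilinear.FDERIV[OF B smooth_has_derivative[OF f c] smooth_has_derivative[OF g c]] c
    by (simp add: o_def)
  from diff_eqI[OF c v this] show ?thesis
    by (simp add: diff_smooth_chart[OF f c v] diff_smooth_chart[OF g c v])
qed

lemma diff_plus:
  fixes f g :: "'m \<Rightarrow> 'b::real_normed_vector"
  assumes f: "smooth_map_on A UNIV f" and g: "smooth_map_on A UNIV g" and v: "v \<in> tangent_space A p"
  shows "diff A (\<lambda>q. f q + g q) p v = diff A f p v + diff A g p v"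
proof -
  obtain c where c: "c \<in> A" "p \<in> fst c" by (rule chart_ex)
  have "(((\<lambda>q. f q + g q) \<circ> chart_inv c) has_derivative
    (\<lambda>v. frechet_derivative (f \<circ> chart_inv c) (at (snd c p)) v
       + frechet_derivative (g \<circ> chart_inv c) (at (snd c p)) v)) (at (snd c p))"
    using has_derivative_add[OF smooth_has_derivative[OF f c] smooth_has_derivative[OF g c]]
    by (simp add: o_def)
  from diff_eqI[OF c v this] show ?thesis
    by (simp add: diff_smooth_chart[OF f c v] diff_smooth_chart[OF g c v])
qed

lemma smooth_linear_compose:
  fixes f :: "'m \<Rightarrow> 'b::real_normed_vector"
  assumes "bounded_linear L" "smooth_map_on A UNIV f"
  shows "smooth_map_on A UNIV (\<lambda>q. L (f q))"
  using smooth_on_linear_compose[OF assms(1) open_chart_image smooth_chart[OF assms(2)]]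
  by (intro smooth_mapI) (simp add: o_def)

lemma smooth_bilinear:
  fixes f :: "'m \<Rightarrow> 'b::real_normed_vector" and g :: "'m \<Rightarrow> 'c::real_normed_vector"
  assumes "bounded_bilinear B" "smooth_map_on A UNIV f" "smooth_map_on A UNIV g"
  shows "smooth_map_on A UNIV (\<lambda>q. B (f q) (g q))"
  using smooth_on_bilinear[OF assms(1) open_chart_image smooth_chart[OF assms(2)] smooth_chart[OF assms(3)]]
  by (intro smooth_mapI) (simp add: o_def)

lemma smooth_map_on_subset:
  fixes f :: "'m \<Rightarrow> 'b::real_normed_vector"
  assumes "smooth_map_on A UNIV f"
  shows "smooth_map_on A U f"
  unfolding smooth_map_on_def
proof
  fix c assume "c \<in> A"
  from smooth_chart[OF assms this] show "smooth_on (snd c ` (fst c \<inter> U)) (f \<circ> chart_inv c)"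
    by (rule smooth_on_subset) blast
qed

section \<open>Vector fields and their commutators\<close>

lemma
  assumes "vector_field A X"
  shows vf_tangent: "X p \<in> tangent_space A p"
    and vf_smooth: "c \<in> A \<Longrightarrow> smooth_on (snd c ` fst c) (\<lambda>x. X (chart_inv c x) c)"
  using assms unfolding vector_field_def by auto

lemma vf_add: "vector_field A X \<Longrightarrow> vector_field A Y \<Longrightarrow> vector_field A (X + Y)"
  unfolding vector_field_def by (simp add: tangent_add smooth_on_add open_chart_image)

lemma vf_scale:
  assumes "smooth_map_on A UNIV f" "vector_field A X"
  shows "vector_field A (fscale f X)"
  using smooth_on_bilinear[OF bounded_bilinear_scaleR open_chart_image smooth_chart[OF assms(1)] vf_smooth[OF assms(2)]]
    assms(2)
  unfolding vector_field_def fscale_def by (simp add: tangent_scale) (simp add: tscale_def o_def)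

lemma bounded_linear_ii: "bounded_linear (\<lambda>v :: complex ^ 'k. \<i> *s v)"
  unfolding linear_conv_bounded_linear[symmetric]
  by (rule linearI) (simp_all add: vec_eq_iff algebra_simps)

lemma vf_J: "vector_field A X \<Longrightarrow> vector_field A (Jfield X)"
  using smooth_on_linear_compose[OF bounded_linear_ii open_chart_image vf_smooth]
  unfolding vector_field_def Jfield_def by (simp add: tangent_J) (simp add: J_def)

lemma diff_field_chart:
  fixes f :: "'m \<Rightarrow> 'b::real_normed_vector"
  assumes "smooth_map_on A UNIV f" "vector_field A X" "c \<in> A" "x \<in> snd c ` fst c"
  shows "diff A f (chart_inv c x) (X (chart_inv c x))
    = frechet_derivative (f \<circ> chart_inv c) (at x) (X (chart_inv c x) c)"
  using diff_smooth_chart[OF assms(1,3) chart_inv_mem vf_tangent[OF assms(2)]] assms(3,4) chart_inv_right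
  by metis

lemma smooth_diff_field:
  fixes f :: "'m \<Rightarrow> 'b::real_normed_vector"
  assumes "smooth_map_on A UNIV f" "vector_field A X"
  shows "smooth_map_on A UNIV (\<lambda>p. diff A f p (X p))"
proof (rule smooth_mapI)
  fix c assume c: "c \<in> A"
  show "smooth_on (snd c ` fst c) ((\<lambda>p. diff A f p (X p)) \<circ> chart_inv c)"
    by (rule smooth_on_cong[OF open_chart_image[OF c] _
          smooth_on_frechet_apply[OF open_chart_image[OF c] smooth_chart[OF assms(1) c] vf_smooth[OF assms(2) c]]])
      (simp add: diff_field_chart[OF assms c])
qed

text \<open>The second derivatives of \<open>f\<close> cancel by symmetry. The right-hand side stays
  in a chart because the bracket is not yet known to transform like a tangent vector.\<close>

lemma diff_lie_bracket:
  fixes f :: "'m \<Rightarrow> 'b::euclidean_space"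
  assumes f: "smooth_map_on A UNIV f" and X: "vector_field A X" and Y: "vector_field A Y"
    and c: "c \<in> A" "p \<in> fst c"
  shows "diff A (\<lambda>q. diff A f q (Y q)) p (X p) - diff A (\<lambda>q. diff A f q (X q)) p (Y p)
    = frechet_derivative (f \<circ> chart_inv c) (at (snd c p)) (lie_bracket A X Y p c)"
proof -
  let ?S = "snd c ` fst c" and ?F = "f \<circ> chart_inv c" and ?x = "snd c p"
  define D where "D u v = frechet_derivative (\<lambda>y. frechet_derivative ?F (at y) u) (at ?x) v" for u v
  note S = open_chart_image[OF c(1)]
  have x: "?x \<in> ?S" using c by simp
  have F: "Ck_on 2 ?S ?F" using smooth_chart[OF f c(1)] by (simp add: smooth_on_def)
  have *: "diff A (\<lambda>q. diff A f q (Z q)) p v = D (v c) (Z p c) + frechet_derivative ?F (at ?x)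
     (frechet_derivative (\<lambda>x. Z (chart_inv c x) c) (at ?x) (v c))"
    if Z: "vector_field A Z" and v: "v \<in> tangent_space A p" for Z v
  proof (rule diff_eqI[OF c v])
    show "((\<lambda>q. diff A f q (Z q)) \<circ> chart_inv c has_derivative
      (\<lambda>v. D v (Z p c) + frechet_derivative ?F (at ?x)
        (frechet_derivative (\<lambda>x. Z (chart_inv c x) c) (at ?x) v))) (at ?x)"
      unfolding D_def
    proof (rule has_derivative_transform_within_open[OF _ S x])
      show "((\<lambda>y. frechet_derivative ?F (at y) (Z (chart_inv c y) c)) has_derivative
        (\<lambda>v. frechet_derivative (\<lambda>y. frechet_derivative ?F (at y) v) (at ?x) (Z p c)
          + frechet_derivative ?F (at ?x)
            (frechet_derivative (\<lambda>x. Z (chart_inv c x) c) (at ?x) v))) (at ?x)"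
        using has_derivative_frechet_apply[OF S F x
            smooth_on_has_derivative[OF vf_smooth[OF Z c(1)] x]]
        by (simp only: chart_inv_left[OF c])
      show "frechet_derivative ?F (at y) (Z (chart_inv c y) c) = ((\<lambda>q. diff A f q (Z q)) \<circ> chart_inv c) y"
        if "y \<in> ?S" for y
        by (simp only: o_apply diff_field_chart[OF f Z c(1) that])
    qed
  qed
  have lin: "linear (frechet_derivative ?F (at ?x))"
    using has_derivative_linear[OF smooth_has_derivative[OF f c]] .
  have "D (X p c) (Y p c) = D (Y p c) (X p c)"
    unfolding D_def by (rule frechet_derivative_symmetric[OF S F x])
  moreover have "lie_bracket A X Y p c
    = frechet_derivative (\<lambda>x. Y (chart_inv c x) c) (at ?x) (X p c)
    - frechet_derivative (\<lambda>x. X (chart_inv c x) c) (at ?x) (Y p c)"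
    using c by (simp add: lie_bracket_def)
  ultimately show ?thesis
    unfolding *[OF Y vf_tangent[OF X]] *[OF X vf_tangent[OF Y]] by (simp only: linear_diff[OF lin] add_diff_cancel_left)
qed

end

section \<open>The flat connection of a local diffeomorphism\<close>

text \<open>\<open>W\<close> is a developing map. Its target has the real dimension of the manifold,
  so injective differentials are bijective.\<close>

locale developed_mfd = complex_mfd A
  for A :: "('m::{t2_space, second_countable_topology}, 'n::finite) chart set" +
  fixes W :: "'m \<Rightarrow> complex ^ 'n"
  assumes W: "smooth_map_on A UNIV W"
    and W_inj: "inj_on (diff A W p) (tangent_space A p)"
begin

lemma chart_derivative_inj:
  assumes c: "c \<in> A" "x \<in> snd c ` fst c"
  shows "inj (frechet_derivative (W \<circ> chart_inv c) (at x))"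
proof (rule injI)
  fix \<xi> \<eta> assume eq: "frechet_derivative (W \<circ> chart_inv c) (at x) \<xi> = frechet_derivative (W \<circ> chart_inv c) (at x) \<eta>"
  obtain p where p: "p \<in> fst c" "x = snd c p" using c by blast
  note T = vec_of_tangent[OF c(1) p(1)] and s = vec_of_self[OF c(1) p(1)]
  have "diff A W p (vec_of c p \<xi>) = diff A W p (vec_of c p \<eta>)"
    using eq by (simp only: diff_smooth_chart[OF W c(1) p(1) T] s p(2))
  from inj_onD[OF W_inj this T T] have "vec_of c p \<xi> = vec_of c p \<eta>" .
  then show "\<xi> = \<eta>" using s by metis
qed

lemma W_surj: "\<exists>v\<in>tangent_space A p. diff A W p v = a"
proof -
  obtain c where c: "c \<in> A" "p \<in> fst c" by (rule chart_ex)
  note inj = chart_derivative_inj[OF c(1) imageI[OF c(2)]]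
  obtain \<xi> where \<xi>: "a = frechet_derivative (W \<circ> chart_inv c) (at (snd c p)) \<xi>"
    using linear_inverse_of_inj(3)[OF has_derivative_linear[OF smooth_has_derivative[OF W c]] inj] by metis
  have "diff A W p (vec_of c p \<xi>) = a"
    by (simp only: diff_smooth_chart[OF W c vec_of_tangent[OF c]] vec_of_self[OF c] \<xi>)
  then show ?thesis using vec_of_tangent[OF c] by blast
qed

lemma W_eqI:
  "u \<in> tangent_space A p \<Longrightarrow> v \<in> tangent_space A p \<Longrightarrow> diff A W p u = diff A W p v \<Longrightarrow> u = v"
  using W_inj by (blast dest: inj_onD)

text \<open>The pullback under \<open>W\<close> of the trivial connection of a vector space. The
  value 0 on other arguments is the normalisation in \<open>connection\<close>.\<close>

definition nabla :: "('m, 'n) conn" where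
  "nabla X Y = (if vector_field A X \<and> vector_field A Y
     then \<lambda>p. inv_into (tangent_space A p) (diff A W p) (diff A (\<lambda>q. diff A W q (Y q)) p (X p))
     else 0)"

context
  fixes X Y
  assumes XY: "vector_field A X" "vector_field A Y"
begin

lemma nabla_tangent: "nabla X Y p \<in> tangent_space A p"
  and diff_nabla: "diff A W p (nabla X Y p) = diff A (\<lambda>q. diff A W q (Y q)) p (X p)"
proof -
  have "diff A (\<lambda>q. diff A W q (Y q)) p (X p) \<in> diff A W p ` tangent_space A p"
    using W_surj by (metis imageI)
  then show "nabla X Y p \<in> tangent_space A p"
    "diff A W p (nabla X Y p) = diff A (\<lambda>q. diff A W q (Y q)) p (X p)"
    using XY by (simp_all add: nabla_def inv_into_into f_inv_into_f)
qed

lemma nabla_vf: "vector_field A (nabla X Y)"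
  unfolding vector_field_def
proof (intro conjI allI ballI nabla_tangent)
  fix c assume c: "c \<in> A"
  \<comment> \<open>In the chart the component of \<open>nabla X Y\<close> solves a linear system
    whose matrix is the derivative of \<open>W\<close> and whose right-hand side is smooth.\<close>
  show "smooth_on (snd c ` fst c) (\<lambda>x. nabla X Y (chart_inv c x) c)"
  proof (rule smooth_on_solution[OF open_chart_image[OF c] smooth_chart[OF W c]
        smooth_chart[OF smooth_diff_field[OF smooth_diff_field[OF W XY(2)] XY(1)] c]
        chart_derivative_inj[OF c]])
    fix x assume x: "x \<in> snd c ` fst c"
    show "frechet_derivative (W \<circ> chart_inv c) (at x) (nabla X Y (chart_inv c x) c)
      = ((\<lambda>p. diff A (\<lambda>q. diff A W q (Y q)) p (X p)) \<circ> chart_inv c) x"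
      using diff_smooth_chart[OF W c chart_inv_mem[OF c x] nabla_tangent] chart_inv_right[OF c x]
      by (simp add: diff_nabla)
  qed
qed

end

lemma nabla_eqI:
  assumes "vector_field A X" "vector_field A Y" "\<And>p. Z p \<in> tangent_space A p"
    and "\<And>p. diff A (\<lambda>q. diff A W q (Y q)) p (X p) = diff A W p (Z p)"
  shows "nabla X Y = Z"
  using W_eqI[OF nabla_tangent[OF assms(1,2)] assms(3)] diff_nabla[OF assms(1,2)] assms(4)
  by (intro ext) metis

lemma field_diff_add:
  "vector_field A X \<Longrightarrow> vector_field A Y \<Longrightarrow>
    (\<lambda>q. diff A W q ((X + Y) q)) = (\<lambda>q. diff A W q (X q) + diff A W q (Y q))"
  by (simp add: diff_add[OF W] vf_tangent)

lemma nabla_connection: "connection A nabla"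
  unfolding connection_def
proof (intro conjI allI impI)
  fix X Y assume X: "vector_field A X" and Y: "vector_field A Y"
  show "vector_field A (nabla X Y)" by (rule nabla_vf[OF X Y])
next
  fix X X' Y assume X: "vector_field A X" "vector_field A X'" and Y: "vector_field A Y"
  show "nabla (X + X') Y = nabla X Y + nabla X' Y"
  proof (rule nabla_eqI[OF vf_add[OF X] Y])
    fix p
    note t = nabla_tangent[OF X(1) Y] nabla_tangent[OF X(2) Y]
    show "(nabla X Y + nabla X' Y) p \<in> tangent_space A p" using tangent_add[OF t] by simp
    show "diff A (\<lambda>q. diff A W q (Y q)) p ((X + X') p) = diff A W p ((nabla X Y + nabla X' Y) p)"
      using diff_add[OF smooth_diff_field[OF W Y] vf_tangent[OF X(1)] vf_tangent[OF X(2)]]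
      by (simp add: diff_add[OF W t] diff_nabla X Y)
  qed
next
  fix f :: "'m \<Rightarrow> real" and X Y
  assume f: "smooth_map_on A UNIV f" and X: "vector_field A X" and Y: "vector_field A Y"
  show "nabla (fscale f X) Y = fscale f (nabla X Y)"
  proof (rule nabla_eqI[OF vf_scale[OF f X] Y])
    fix p
    note t = nabla_tangent[OF X Y]
    show "fscale f (nabla X Y) p \<in> tangent_space A p" unfolding fscale_def by (rule tangent_scale[OF t])
    show "diff A (\<lambda>q. diff A W q (Y q)) p (fscale f X p) = diff A W p (fscale f (nabla X Y) p)"
      unfolding fscale_def
      by (simp add: diff_scale[OF W t] diff_scale[OF smooth_diff_field[OF W Y] vf_tangent[OF X]] diff_nabla X Y)
  qed
  show "nabla X (fscale f Y) = fscale (deriv_along A X f) Y + fscale f (nabla X Y)"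
  proof (rule nabla_eqI[OF X vf_scale[OF f Y]])
    fix p
    note t = tangent_scale[OF vf_tangent[OF Y, of p], of "deriv_along A X f p"]
      tangent_scale[OF nabla_tangent[OF X Y, of p], of "f p"]
    show "(fscale (deriv_along A X f) Y + fscale f (nabla X Y)) p \<in> tangent_space A p"
      using tangent_add[OF t] unfolding fscale_def by simp
    have "diff A (\<lambda>q. diff A W q (fscale f Y q)) p (X p) = diff A (\<lambda>q. f q *\<^sub>R diff A W q (Y q)) p (X p)"
      unfolding fscale_def by (simp add: diff_scale[OF W vf_tangent[OF Y]])
    also have "\<dots> = f p *\<^sub>R diff A W p (nabla X Y p) + deriv_along A X f p *\<^sub>R diff A W p (Y p)"
      by (simp add: diff_bilinear[OF bounded_bilinear_scaleR f smooth_diff_field[OF W Y] vf_tangent[OF X]]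
          diff_nabla X Y deriv_along_def)
    also have "\<dots> = diff A W p ((fscale (deriv_along A X f) Y + fscale f (nabla X Y)) p)"
      by (simp add: fscale_def diff_add[OF W t] diff_scale[OF W] vf_tangent[OF Y] nabla_tangent[OF X Y])
    finally show "diff A (\<lambda>q. diff A W q (fscale f Y q)) p (X p)
      = diff A W p ((fscale (deriv_along A X f) Y + fscale f (nabla X Y)) p)" .
  qed
next
  fix X Y Y' assume X: "vector_field A X" and Y: "vector_field A Y" "vector_field A Y'"
  show "nabla X (Y + Y') = nabla X Y + nabla X Y'"
  proof (rule nabla_eqI[OF X vf_add[OF Y]])
    fix p
    note t = nabla_tangent[OF X Y(1)] nabla_tangent[OF X Y(2)]
    show "(nabla X Y + nabla X Y') p \<in> tangent_space A p" using tangent_add[OF t] by simp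
    show "diff A (\<lambda>q. diff A W q ((Y + Y') q)) p (X p) = diff A W p ((nabla X Y + nabla X Y') p)"
      unfolding field_diff_add[OF Y]
        diff_plus[OF smooth_diff_field[OF W Y(1)] smooth_diff_field[OF W Y(2)] vf_tangent[OF X]]
      by (simp add: diff_add[OF W t] diff_nabla X Y)
  qed
next
  fix X Y assume "\<not> (vector_field A X \<and> vector_field A Y)"
  then show "nabla X Y = 0" unfolding nabla_def by argo
qed

text \<open>The comparison is made on components: \<open>diff_lie_bracket\<close> for
  \<open>W\<close> gives equal images under the injective chart derivative, and outside the charts
  around \<open>p\<close> both sides are 0.\<close>

lemma lie_bracket_eq:
  assumes X: "vector_field A X" and Y: "vector_field A Y"
  shows "lie_bracket A X Y = nabla X Y - nabla Y X"
proof (intro ext)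
  fix p c
  note t = nabla_tangent[OF X Y, of p] nabla_tangent[OF Y X, of p]
  show "lie_bracket A X Y p c = (nabla X Y - nabla Y X) p c"
  proof (cases "c \<in> A \<and> p \<in> fst c")
    case True
    then have c: "c \<in> A" "p \<in> fst c" by auto
    have "frechet_derivative (W \<circ> chart_inv c) (at (snd c p)) (lie_bracket A X Y p c)
      = diff A W p (nabla X Y p - nabla Y X p)"
      unfolding diff_lie_bracket[OF W X Y c, symmetric] diff_diff[OF W t] by (simp add: diff_nabla X Y)
    then show ?thesis
      unfolding diff_smooth_chart[OF W c tangent_diff[OF t]]
      using chart_derivative_inj[OF c(1) imageI[OF c(2)]] by (simp add: inj_eq)
  next
    case False
    then show ?thesis
      using tangent_outside[OF tangent_diff[OF t] False] by (auto simp: lie_bracket_def)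
  qed
qed

text \<open>The identification with \<open>nabla X Y - nabla Y X\<close> yields the transformation
  law of the bracket without second derivatives of transition maps.\<close>

lemma lie_bracket_vf:
  assumes X: "vector_field A X" and Y: "vector_field A Y"
  shows "vector_field A (lie_bracket A X Y)"
proof -
  have "vector_field A (fscale (\<lambda>p. -1) (nabla Y X))"
    by (intro vf_scale nabla_vf X Y smooth_mapI)
      (simp add: o_def smooth_on_def Ck_on_const open_chart_image)
  then have "vector_field A (nabla X Y + fscale (\<lambda>p. -1) (nabla Y X))"
    by (rule vf_add[OF nabla_vf[OF X Y]])
  moreover have "nabla X Y + fscale (\<lambda>p. -1) (nabla Y X) = lie_bracket A X Y"
    unfolding lie_bracket_eq[OF X Y] by (intro ext) (simp add: fscale_def tscale_def)
  ultimately show ?thesis by simp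
qed

lemma nabla_torsionfree: "torsionfree A nabla"
  unfolding torsionfree_def using lie_bracket_eq by simp

text \<open>Now that the bracket is tangent, the chart formula becomes invariant. Vector-valued
  \<open>f\<close> are allowed so that \<open>W\<close>, \<open>dW(Z)\<close> and \<open>W'\<close>
  can be inserted.\<close>

lemma diff_commutator:
  fixes f :: "'m \<Rightarrow> 'b::euclidean_space"
  assumes f: "smooth_map_on A UNIV f" and X: "vector_field A X" and Y: "vector_field A Y"
  shows "diff A (\<lambda>q. diff A f q (Y q)) p (X p) - diff A (\<lambda>q. diff A f q (X q)) p (Y p)
    = diff A f p (lie_bracket A X Y p)"
proof -
  obtain c where c: "c \<in> A" "p \<in> fst c" by (rule chart_ex)
  show ?thesis
    unfolding diff_lie_bracket[OF f X Y c]
    by (rule diff_smooth_chart[OF f c vf_tangent[OF lie_bracket_vf[OF X Y]], symmetric])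
qed

lemma nabla_flat: "flat A nabla"
  unfolding flat_def
proof (intro allI impI)
  fix X Y Z assume X: "vector_field A X" and Y: "vector_field A Y" and Z: "vector_field A Z"
  let ?g = "\<lambda>q. diff A W q (Z q)"
  note g = smooth_diff_field[OF W Z] and B = lie_bracket_vf[OF X Y]
  have t: "(nabla X (nabla Y Z) - nabla Y (nabla X Z)) p \<in> tangent_space A p" for p
    using tangent_diff[OF nabla_tangent[OF X nabla_vf[OF Y Z]] nabla_tangent[OF Y nabla_vf[OF X Z]]]
    by simp
  have "nabla (lie_bracket A X Y) Z = nabla X (nabla Y Z) - nabla Y (nabla X Z)"
  proof (rule nabla_eqI[OF B Z t])
    fix p
    show "diff A ?g p (lie_bracket A X Y p) = diff A W p ((nabla X (nabla Y Z) - nabla Y (nabla X Z)) p)"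
      unfolding diff_commutator[OF g X Y, symmetric]
      using diff_diff[OF W nabla_tangent[OF X nabla_vf[OF Y Z]] nabla_tangent[OF Y nabla_vf[OF X Z]]]
      by (simp add: diff_nabla X Y Z nabla_vf)
  qed
  then show "nabla X (nabla Y Z) - nabla Y (nabla X Z) - nabla (lie_bracket A X Y) Z = 0" by simp
qed

text \<open>\<open>dW \<circ> J\<close> is again an exact form \<open>dW'\<close> when \<open>W\<close> is the real part of a holomorphic map, so the
  argument for torsionfreeness applies to \<open>W'\<close> as well.\<close>

lemma nablaJ_symmetric:
  assumes W': "smooth_map_on A UNIV W'"
    and J: "\<And>p v. v \<in> tangent_space A p \<Longrightarrow> diff A W p (J v) = diff A W' p v"
    and X: "vector_field A X" and Y: "vector_field A Y"
  shows "nablaJ nabla X Y = nablaJ nabla Y X"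
proof
  fix p
  \<comment> \<open>Under \<open>dW\<close> the tensor becomes the Hessian of \<open>W'\<close>,
    whose antisymmetric part vanishes by the commutator rule and torsionfreeness.\<close>
  have *: "diff A W p (nablaJ nabla X Y p) =
      diff A (\<lambda>q. diff A W' q (Y q)) p (X p) - diff A W' p (nabla X Y p)"
    "nablaJ nabla X Y p \<in> tangent_space A p"
    if X: "vector_field A X" and Y: "vector_field A Y" for X Y
  proof -
    note t = nabla_tangent[OF X vf_J[OF Y]] tangent_J[OF nabla_tangent[OF X Y]]
    have n: "nablaJ nabla X Y p = nabla X (Jfield Y) p - J (nabla X Y p)"
      by (simp add: nablaJ_def Jfield_def)
    show "nablaJ nabla X Y p \<in> tangent_space A p" unfolding n by (rule tangent_diff[OF t])
    have "(\<lambda>q. diff A W q (Jfield Y q)) = (\<lambda>q. diff A W' q (Y q))"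
      by (simp add: Jfield_def J vf_tangent[OF Y])
    then show "diff A W p (nablaJ nabla X Y p) =
      diff A (\<lambda>q. diff A W' q (Y q)) p (X p) - diff A W' p (nabla X Y p)"
      unfolding n diff_diff[OF W t] by (simp add: diff_nabla X Y vf_J J nabla_tangent)
  qed
  have "diff A W' p (lie_bracket A X Y p) = diff A W' p (nabla X Y p) - diff A W' p (nabla Y X p)"
    using diff_diff[OF W' nabla_tangent[OF X Y] nabla_tangent[OF Y X]] by (simp add: lie_bracket_eq X Y)
  then have "diff A W p (nablaJ nabla X Y p) = diff A W p (nablaJ nabla Y X p)"
    unfolding *(1)[OF X Y] *(1)[OF Y X]
    using diff_commutator[OF W' X Y, of p] by (simp add: algebra_simps)
  then show "nablaJ nabla X Y p = nablaJ nabla Y X p"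
    by (rule W_eqI[OF *(2)[OF X Y] *(2)[OF Y X]])
qed

section \<open>Pullbacks of constant symplectic forms\<close>

definition pulled_form :: "(complex ^ 'n \<Rightarrow> complex ^ 'n \<Rightarrow> real) \<Rightarrow> ('m, 'n) form2" where
  "pulled_form \<beta> p u v = \<beta> (diff A W p u) (diff A W p v)"

context
  fixes \<beta> :: "complex ^ 'n \<Rightarrow> complex ^ 'n \<Rightarrow> real"
  assumes \<beta>: "bounded_bilinear \<beta>" and \<beta>_skew: "\<And>a b. \<beta> a b = - \<beta> b a"
    and \<beta>_nondeg: "\<And>a. (\<And>b. \<beta> a b = 0) \<Longrightarrow> a = 0"
begin

text \<open>Product rule for constant coefficients: the derivative falls only on
  \<open>dW(Y)\<close> and \<open>dW(Z)\<close>. Parallelism is this identity rearranged; closedness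
  is its cyclic sum.\<close>

lemma deriv_pulled_form:
  assumes X: "vector_field A X" and Y: "vector_field A Y" and Z: "vector_field A Z"
  shows "deriv_along A X (\<lambda>q. pulled_form \<beta> q (Y q) (Z q)) p
    = pulled_form \<beta> p (nabla X Y p) (Z p) + pulled_form \<beta> p (Y p) (nabla X Z p)"
  unfolding deriv_along_def pulled_form_def
    diff_bilinear[OF \<beta> smooth_diff_field[OF W Y] smooth_diff_field[OF W Z] vf_tangent[OF X]]
  by (simp add: diff_nabla X Y Z)

lemma pulled_form_two_form: "two_form A (pulled_form \<beta>)"
  unfolding two_form_def
proof (intro conjI allI ballI impI)
  fix p u v w r assume t: "u \<in> tangent_space A p" "v \<in> tangent_space A p"
  show "pulled_form \<beta> p (u + v) w = pulled_form \<beta> p u w + pulled_form \<beta> p v w"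
    unfolding pulled_form_def diff_add[OF W t] by (rule bounded_bilinear.add_left[OF \<beta>])
  show "pulled_form \<beta> p (tscale r u) w = r * pulled_form \<beta> p u w"
    unfolding pulled_form_def diff_scale[OF W t(1)]
    by (simp add: bounded_bilinear.scaleR_left[OF \<beta>])
  show "pulled_form \<beta> p u v = - pulled_form \<beta> p v u"
    unfolding pulled_form_def by (rule \<beta>_skew)
next
  fix X Y assume X: "vector_field A X" and Y: "vector_field A Y"
  show "smooth_map_on A UNIV (\<lambda>p. pulled_form \<beta> p (X p) (Y p))"
    unfolding pulled_form_def by (intro smooth_bilinear[OF \<beta>] smooth_diff_field W X Y)
qed

lemma pulled_form_symplectic: "symplectic_form A (pulled_form \<beta>)"
  unfolding symplectic_form_def
proof (intro conjI pulled_form_two_form)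
  show "closed_form A (pulled_form \<beta>)"
    unfolding closed_form_def
  proof (intro allI impI)
    fix X Y Z p assume v: "vector_field A X" "vector_field A Y" "vector_field A Z"
    have b: "pulled_form \<beta> p (lie_bracket A U V p) w = pulled_form \<beta> p (nabla U V p) w - pulled_form \<beta> p (nabla V U p) w"
      if "vector_field A U" "vector_field A V" for U V w
      unfolding pulled_form_def lie_bracket_eq[OF that] minus_apply
        diff_diff[OF W nabla_tangent[OF that] nabla_tangent[OF that(2,1)]]
      by (rule bounded_bilinear.diff_left[OF \<beta>])
    have s: "pulled_form \<beta> p u w = - pulled_form \<beta> p w u" for u w
      unfolding pulled_form_def by (rule \<beta>_skew)
    show "deriv_along A X (\<lambda>q. pulled_form \<beta> q (Y q) (Z q)) p
        + deriv_along A Y (\<lambda>q. pulled_form \<beta> q (Z q) (X q)) p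
        + deriv_along A Z (\<lambda>q. pulled_form \<beta> q (X q) (Y q)) p
        - pulled_form \<beta> p (lie_bracket A X Y p) (Z p)
        - pulled_form \<beta> p (lie_bracket A Y Z p) (X p)
        - pulled_form \<beta> p (lie_bracket A Z X p) (Y p) = 0"
      unfolding deriv_pulled_form[OF v] deriv_pulled_form[OF v(2,3,1)] deriv_pulled_form[OF v(3,1,2)]
        b[OF v(1,2)] b[OF v(2,3)] b[OF v(3,1)]
      \<comment> \<open>Expanding the brackets cancels the terms with \<open>nabla\<close> in the
        first slot of each derivative; the remaining six terms cancel in pairs by skewness.\<close>
      using s[of "Y p" "nabla X Z p"] s[of "Z p" "nabla Y X p"] s[of "X p" "nabla Z Y p"] by simp
  qed
  show "nondegenerate A (pulled_form \<beta>)"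
    unfolding nondegenerate_def
  proof (intro allI ballI impI)
    fix p u assume u: "u \<in> tangent_space A p" and 0: "\<forall>v\<in>tangent_space A p. pulled_form \<beta> p u v = 0"
    have "diff A W p u = 0"
    proof (rule \<beta>_nondeg)
      fix b
      obtain v where "v \<in> tangent_space A p" "diff A W p v = b" using W_surj by blast
      then show "\<beta> (diff A W p u) b = 0" using 0 unfolding pulled_form_def by blast
    qed
    \<comment> \<open>\<open>u - u\<close> presents the zero vector as a tangent vector whose image
      under \<open>dW\<close> is known to be 0.\<close>
    moreover have t: "u - u \<in> tangent_space A p" by (rule tangent_diff[OF u u])
    ultimately have "diff A W p u = diff A W p (u - u)" using diff_diff[OF W u u] by simp
    from W_eqI[OF u t this] show "u = 0" by simp
  qed
qed

lemma pulled_form_parallel: "parallel_form A nabla (pulled_form \<beta>)"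
  unfolding parallel_form_def using deriv_pulled_form by simp

end

section \<open>Affine functions and uniqueness of the connection\<close>

lemma affine_coordinate:
  fixes L :: "complex ^ 'n \<Rightarrow> real"
  assumes L: "bounded_linear L"
  shows "affine_on A nabla U (\<lambda>q. L (W q))"
  unfolding affine_on_def
proof (intro conjI allI impI ballI)
  note LW = smooth_linear_compose[OF L W]
  show "smooth_map_on A U (\<lambda>q. L (W q))" by (rule smooth_map_on_subset[OF LW])
  fix X Y p assume X: "vector_field A X" and Y: "vector_field A Y"
  have "deriv_along A Y (\<lambda>q. L (W q)) = (\<lambda>q. L (diff A W q (Y q)))"
    unfolding deriv_along_def by (simp add: diff_linear_compose[OF L W])
  then show "deriv_along A X (deriv_along A Y (\<lambda>q. L (W q))) p - diff A (\<lambda>q. L (W q)) p (nabla X Y p) = 0"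
    unfolding diff_linear_compose[OF L W] diff_nabla[OF X Y]
    by (simp add: deriv_along_def diff_linear_compose[OF L smooth_diff_field[OF W Y]])
qed

text \<open>The real and imaginary parts together give every component of the equation defining
  \<open>nabla\<close>; on other arguments both connections are normalised to 0.\<close>

lemma nabla_unique:
  assumes D: "connection A D"
    and aff: "\<And>i. affine_on A D UNIV (\<lambda>q. Re (W q $ i))" "\<And>i. affine_on A D UNIV (\<lambda>q. Im (W q $ i))"
  shows "D = nabla"
proof (rule ext, rule ext)
  fix X Y
  show "D X Y = nabla X Y"
  proof (cases "vector_field A X \<and> vector_field A Y")
    case False
    then show ?thesis using D nabla_connection unfolding connection_def by metis
  next
    case True
    then have X: "vector_field A X" and Y: "vector_field A Y" by auto
    have "\<forall>X Y. vector_field A X \<longrightarrow> vector_field A Y \<longrightarrow> vector_field A (D X Y)"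
      using D unfolding connection_def by (rule conjunct1)
    then have t: "D X Y p \<in> tangent_space A p" for p
      using X Y vf_tangent by simp
    have comp: "L (diff A (\<lambda>q. diff A W q (Y q)) p (X p)) = L (diff A W p (D X Y p))"
      if L: "bounded_linear L" and a: "affine_on A D UNIV (\<lambda>q. L (W q))" for p and L :: "complex ^ 'n \<Rightarrow> real"
    proof -
      have "deriv_along A Y (\<lambda>q. L (W q)) = (\<lambda>q. L (diff A W q (Y q)))"
        unfolding deriv_along_def by (simp add: diff_linear_compose[OF L W])
      moreover have "deriv_along A X (deriv_along A Y (\<lambda>q. L (W q))) p = diff A (\<lambda>q. L (W q)) p (D X Y p)"
        using a X Y unfolding affine_on_def by simp
      ultimately show ?thesis
        by (simp add: deriv_along_def diff_linear_compose[OF L smooth_diff_field[OF W Y]]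
            diff_linear_compose[OF L W])
    qed
    have "bounded_linear (\<lambda>v::complex ^ 'n. Re (v $ i))" "bounded_linear (\<lambda>v::complex ^ 'n. Im (v $ i))" for i
      by (rule bounded_linear_compose[OF bounded_linear_Re bounded_linear_vec_nth]
          bounded_linear_compose[OF bounded_linear_Im bounded_linear_vec_nth])+
    from comp[OF this(1) aff(1)] comp[OF this(2) aff(2)]
    have "nabla X Y = D X Y"
      by (intro nabla_eqI[OF X Y t]) (simp add: vec_eq_iff complex_eq_iff)
    then show ?thesis by simp
  qed
qed

end

section \<open>Local coordinates obtained from \<open>W\<close>\<close>

context developed_mfd
begin

text \<open>\<open>G\<close> inverts \<open>W\<close> as read in the chart \<open>c\<close>, so it
  expresses the coordinates of \<open>c\<close> smoothly through the values of
  \<open>W\<close>.\<close>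

lemma W_local_inverse:
  obtains U c G where "p \<in> U" "open U" "c \<in> A" "U \<subseteq> fst c" "open (W ` U)"
    "\<And>q. q \<in> U \<Longrightarrow> G (W q) = snd c q" "smooth_on (W ` U) G"
proof -
  obtain c where c: "c \<in> A" "p \<in> fst c" by (rule chart_ex)
  obtain V G where V: "open V" "V \<subseteq> snd c ` fst c" "snd c p \<in> V" "open ((W \<circ> chart_inv c) ` V)"
      "\<And>y. y \<in> V \<Longrightarrow> G ((W \<circ> chart_inv c) y) = y" "smooth_on ((W \<circ> chart_inv c) ` V) G"
    using inverse_function_smooth[OF open_chart_image[OF c(1)] smooth_chart[OF W c(1)]
        imageI[OF c(2)] chart_derivative_inj[OF c(1)]] by metis
  define U where "U = fst c \<inter> snd c -` V"
  have "open U"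
    unfolding U_def
    by (rule continuous_open_preimage[OF _ open_chart[OF c(1)] V(1)])
      (use chart_homeomorphism[OF c(1)] in \<open>simp add: homeomorphism_def\<close>)
  moreover have "U \<subseteq> fst c" "p \<in> U" unfolding U_def using c V(3) by auto
  moreover have "W ` U = (W \<circ> chart_inv c) ` V"
  proof
    show "W ` U \<subseteq> (W \<circ> chart_inv c) ` V"
    proof
      fix a assume "a \<in> W ` U"
      then obtain q where q: "q \<in> fst c" "snd c q \<in> V" "a = W q" unfolding U_def by blast
      then show "a \<in> (W \<circ> chart_inv c) ` V" using c(1) by (intro image_eqI[of _ _ "snd c q"]) auto
    qed
    show "(W \<circ> chart_inv c) ` V \<subseteq> W ` U"
    proof
      fix a assume "a \<in> (W \<circ> chart_inv c) ` V"
      then obtain y where y: "y \<in> V" "a = W (chart_inv c y)" by auto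
      then have "y \<in> snd c ` fst c" using V(2) by blast
      then have "chart_inv c y \<in> U"
        unfolding U_def using chart_inv_mem[OF c(1)] chart_inv_right[OF c(1)] y by auto
      then show "a \<in> W ` U" using y by blast
    qed
  qed
  moreover have "G (W q) = snd c q" if "q \<in> U" for q
    using that V(5)[of "snd c q"] c(1) unfolding U_def by auto
  ultimately show thesis using that[of U c G] V(4,6) c(1) by metis
qed

lemma linear_W_local_coordinates:
  fixes E :: "complex ^ 'n \<Rightarrow> 'b::euclidean_space"
  assumes E: "bounded_linear E" and E': "bounded_linear E'"
    and E'E: "\<And>a. E' (E a) = a" and EE': "\<And>b. E (E' b) = b"
  shows "\<exists>U. p \<in> U \<and> local_coordinates A U (\<lambda>q. E (W q))"
proof -
  let ?\<xi> = "\<lambda>q. E (W q)"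
  obtain U c G where U: "p \<in> U" "open U" "c \<in> A" "U \<subseteq> fst c" "open (W ` U)"
    and G: "\<And>q. q \<in> U \<Longrightarrow> G (W q) = snd c q" "smooth_on (W ` U) G"
    using W_local_inverse[of p] by blast
  have injW: "inj_on W U"
    using G(1) chart_inv_left[OF U(3)] U(4) by (intro inj_onI) (metis subsetD)
  \<comment> \<open>Images under \<open>W\<close> are preimages under the continuous
    \<open>G\<close> of open sets in the chart \<open>c\<close>.\<close>
  have open_W: "open (W ` V)" if V: "open V" "V \<subseteq> U" for V
  proof -
    have "continuous_on (W ` U) G" using G(2) unfolding smooth_on_def by (metis Ck_on.simps(1))
    then have "open (W ` U \<inter> G -` (snd c ` V))"
      using U V by (intro continuous_open_preimage open_chart_subimage) auto
    moreover have "W ` U \<inter> G -` (snd c ` V) = W ` V"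
    proof
      show "W ` U \<inter> G -` (snd c ` V) \<subseteq> W ` V"
      proof
        fix a assume "a \<in> W ` U \<inter> G -` (snd c ` V)"
        then obtain q r where q: "q \<in> U" "a = W q" "r \<in> V" "snd c q = snd c r" using G(1) by auto
        then have "q = r" using chart_inv_left[OF U(3)] U(4) V(2) by (metis subsetD)
        then show "a \<in> W ` V" using q by blast
      qed
      show "W ` V \<subseteq> W ` U \<inter> G -` (snd c ` V)" using V(2) G(1) by auto
    qed
    ultimately show ?thesis by simp
  qed
  have open_\<xi>: "open (?\<xi> ` V)" if "open V" "V \<subseteq> U" for V
  proof -
    have "?\<xi> ` V = E' -` (W ` V)"
      using E'E EE' by (auto simp: image_iff) metis
    moreover have "continuous_on UNIV E'" using E' by (rule linear_continuous_on)
    ultimately show ?thesis using open_W[OF that] by (simp add: open_vimage)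
  qed
  have "local_coordinates A U ?\<xi>"
    unfolding local_coordinates_def
  proof (intro conjI ballI)
    show "open U" by fact
    show inj: "inj_on ?\<xi> U" using injW E'E by (intro inj_onI) (metis inj_onD)
    show "open (?\<xi> ` U)" using open_\<xi> U(2) by simp
    show "smooth_map_on A U ?\<xi>" by (rule smooth_map_on_subset[OF smooth_linear_compose[OF E W]])
    fix c' assume c': "c' \<in> A"
    let ?O = "?\<xi> ` (U \<inter> fst c')"
    have O: "open ?O" using U open_chart[OF c'] by (intro open_\<xi>) auto
    have "smooth_on ?O E'" by (rule smooth_on_linear[OF E' O])
    then have G': "smooth_on ?O (\<lambda>y. G (E' y))"
      by (rule smooth_on_compose[OF O U(5) _ G(2), rotated]) (auto simp: E'E)
    \<comment> \<open>The inverse coordinates reach an arbitrary chart \<open>c'\<close> in three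
      steps: \<open>E'\<close>, then \<open>G\<close> into \<open>c\<close>, then the transition to
      \<open>c'\<close>.\<close>
    have "smooth_on ?O (\<lambda>y. (snd c' \<circ> chart_inv c) (G (E' y)))"
    proof (rule smooth_on_compose[OF O _ _ transition_smooth[OF U(3) c'] G'])
      show "open (snd c ` (fst c \<inter> fst c'))"
        by (intro open_chart_subimage open_Int open_chart U(3) c') simp
      show "(\<lambda>y. G (E' y)) ` ?O \<subseteq> snd c ` (fst c \<inter> fst c')"
        using U(4) by (auto simp: E'E G(1))
    qed
    then show "smooth_on ?O (snd c' \<circ> inv_into U ?\<xi>)"
    proof (rule smooth_on_cong[OF O, rotated])
      fix y assume "y \<in> ?O"
      then obtain q where q: "q \<in> U" "y = ?\<xi> q" by blast
      have "inv_into U ?\<xi> y = q" unfolding q(2) by (rule inv_into_f_f[OF inj q(1)])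
      then show "(snd c' \<circ> chart_inv c) (G (E' y)) = (snd c' \<circ> inv_into U ?\<xi>) y"
        using q U(3,4) by (auto simp: E'E G(1))
    qed
  qed
  then show ?thesis using U(1) by blast
qed

end

section \<open>Totally complex immersions\<close>

text \<open>The real part \<open>V \<rightarrow> V\<^sup>\<tau> = T\<^sup>*\<real>\<^sup>n\<close>, with \<open>T\<^sup>*\<real>\<^sup>n\<close> identified with \<open>\<complex>\<^sup>n\<close> through
  \<open>x\<^sup>i + \<i> y\<^sub>i\<close>, so that the inverse function theorem applies to self-maps of one space.\<close>

definition real_part :: "'n::finite cotangent \<Rightarrow> complex ^ 'n" where
  "real_part v = (\<chi> i. Complex (xV i v) (yV i v))"

text \<open>Twice the imaginary part of the Hermitian product of \<open>a\<close> and
  \<open>b\<close>, conjugate-linear in \<open>a\<close>.\<close>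

definition std_form :: "complex ^ 'n::finite \<Rightarrow> complex ^ 'n \<Rightarrow> real" where
  "std_form a b = 2 * (\<Sum>i\<in>UNIV. Re (a $ i) * Im (b $ i) - Re (b $ i) * Im (a $ i))"

lemma real_part_linear: "bounded_linear (real_part :: 'n::finite cotangent \<Rightarrow> complex ^ 'n)"
  unfolding linear_conv_bounded_linear[symmetric]
  by (rule linearI) (simp_all add: real_part_def xV_def yV_def vec_eq_iff complex_eq_iff)

lemma real_part_eq_0:
  assumes "real_part v = 0"
  shows "\<i> *s v \<in> real_points"
proof -
  have "Re (v $ k) = 0" for k
    using assms by (cases k) (simp_all add: real_part_def xV_def yV_def vec_eq_iff complex_eq_iff)
  then show ?thesis by (simp add: real_points_def \<tau>_def vec_eq_iff complex_eq_iff)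
qed

lemma std_form_bilinear: "bounded_bilinear (std_form :: complex ^ 'n::finite \<Rightarrow> _)"
  unfolding bilinear_conv_bounded_bilinear[symmetric] bilinear_def
  by (auto intro!: linearI simp: std_form_def algebra_simps sum.distrib sum_distrib_left sum_subtractf)

lemma std_form_skew: "std_form a b = - std_form b a"
  unfolding std_form_def by (simp add: sum_negf[symmetric] algebra_simps del: sum_negf)

lemma std_form_nondeg:
  assumes "\<And>b. std_form a b = 0"
  shows "a = 0"
proof -
  \<comment> \<open>Pairing \<open>a\<close> with \<open>\<i> *s a\<close> gives twice its squared
    Hermitian norm.\<close>
  have "(\<Sum>i\<in>UNIV. (Re (a $ i))\<^sup>2 + (Im (a $ i))\<^sup>2) = 0"
    using assms[of "\<i> *s a"] by (simp add: std_form_def power2_eq_square)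
  then have "(Re (a $ i))\<^sup>2 + (Im (a $ i))\<^sup>2 = 0" for i
    by (subst (asm) sum_nonneg_eq_0_iff) auto
  then show ?thesis by (simp add: vec_eq_iff complex_eq_iff sum_power2_eq_zero_iff)
qed

text \<open>The coordinates \<open>xV i\<close> and \<open>yV i\<close> are linear, hence their own
  derivatives at every point: the form on \<open>V\<close> has constant coefficients.\<close>

lemma dx_dy_eq: "2 * dx_dy a u v = std_form (real_part u) (real_part v)"
proof -
  have "bounded_linear (xV i)" "bounded_linear (yV i)" for i :: 'a
    unfolding xV_def[abs_def] yV_def[abs_def]
    by (rule bounded_linear_compose[OF bounded_linear_Re bounded_linear_vec_nth])+
  then have "frechet_derivative (xV i) (at a) = xV i" "frechet_derivative (yV i) (at a) = yV i" for i :: 'a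
    using bounded_linear_imp_has_derivative frechet_derivative_at by metis+
  then show ?thesis
    by (simp add: dx_dy_def wedge_def std_form_def real_part_def)
qed

theorem theorem2:
  fixes A :: "('m::{t2_space, second_countable_topology}, 'n::finite) chart set"
    and \<phi> :: "'m \<Rightarrow> 'n cotangent"
  assumes "complex_manifold A"
    and "totally_complex_immersion A \<phi>"
  shows "special_symplectic_manifold A (induced_connection A \<phi>) (induced_form A \<phi>) \<and>
         (\<forall>p. \<exists>U. p \<in> U \<and>
           real_special_coordinates A (induced_connection A \<phi>) (induced_form A \<phi>) U
             (\<lambda>q. \<chi> i. (xV i \<circ> \<phi>) q) (\<lambda>q. \<chi> i. (yV i \<circ> \<phi>) q))"
proof -
  interpret complex_mfd A by unfold_locales (rule assms(1))
  have holo: "\<And>c. c \<in> A \<Longrightarrow> holo_on (snd c ` fst c) (\<phi> \<circ> chart_inv c)"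
    and imm: "\<And>p. inj_on (diff A \<phi> p) (tangent_space A p)"
    and tc: "\<And>p. real_points \<inter> diff A \<phi> p ` tangent_space A p = {0}"
    using assms(2) unfolding totally_complex_immersion_def holomorphic_immersion_def holomorphic_map_def
    by auto
  have smooth: "smooth_map_on A UNIV \<phi>"
    using holo by (intro smooth_mapI) (simp add: holo_on_def)
  \<comment> \<open>Holomorphy enters here: the Cauchy-Riemann equations in one chart make the
    differential of \<open>\<phi>\<close> complex linear.\<close>
  have d\<phi>_J: "diff A \<phi> p (J v) = \<i> *s diff A \<phi> p v" if v: "v \<in> tangent_space A p" for p v
  proof -
    obtain c where c: "c \<in> A" "p \<in> fst c" by (rule chart_ex)
    show ?thesis
      unfolding diff_smooth_chart[OF smooth c v] diff_smooth_chart[OF smooth c tangent_J[OF v]]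
      using holo[OF c(1)] c(2) by (simp add: holo_on_def J_def)
  qed
  define W where "W q = real_part (\<phi> q)" for q
  have W: "smooth_map_on A UNIV W"
    unfolding W_def by (rule smooth_linear_compose[OF real_part_linear smooth])
  have dW: "diff A W p v = real_part (diff A \<phi> p v)" for p v
    unfolding W_def by (rule diff_linear_compose[OF real_part_linear smooth])
  have W_inj: "inj_on (diff A W p) (tangent_space A p)" for p
  proof (rule inj_onI)
    fix u v assume t: "u \<in> tangent_space A p" "v \<in> tangent_space A p" and eq: "diff A W p u = diff A W p v"
    note t' = tangent_diff[OF t]
    have "real_part (diff A \<phi> p (u - v)) = 0"
      using diff_diff[OF W t] eq dW by simp
    from real_part_eq_0[OF this] have "diff A \<phi> p (J (u - v)) \<in> real_points"
      by (simp add: d\<phi>_J[OF t'])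
    then have "diff A \<phi> p (J (u - v)) = 0" using tc tangent_J[OF t'] by blast
    then have "diff A \<phi> p (u - v) = 0" by (simp add: d\<phi>_J[OF t'] vec_eq_iff)
    then have "diff A \<phi> p u = diff A \<phi> p v" using diff_diff[OF smooth t] by simp
    from inj_onD[OF imm this t] show "u = v" .
  qed
  interpret developed_mfd A W by unfold_locales (rule W W_inj)+
  \<comment> \<open>This turns the affinity conditions in \<open>induced_connection\<close> into
    conditions on the components of \<open>W\<close>, as in \<open>nabla_unique\<close>.\<close>
  have coord: "xV i \<circ> \<phi> = (\<lambda>q. Re (W q $ i))" "yV i \<circ> \<phi> = (\<lambda>q. Im (W q $ i))" for i
    by (simp_all add: W_def real_part_def fun_eq_iff)
  have lin: "bounded_linear (\<lambda>v::complex ^ 'n. Re (v $ i))" "bounded_linear (\<lambda>v::complex ^ 'n. Im (v $ i))" for i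
    by (rule bounded_linear_compose[OF bounded_linear_Re bounded_linear_vec_nth]
        bounded_linear_compose[OF bounded_linear_Im bounded_linear_vec_nth])+
  have conn: "induced_connection A \<phi> = nabla"
    unfolding induced_connection_def coord
  proof (rule the_equality)
    show "connection A nabla \<and> flat A nabla \<and> torsionfree A nabla \<and>
      (\<forall>i. affine_on A nabla UNIV (\<lambda>q. Re (W q $ i)) \<and> affine_on A nabla UNIV (\<lambda>q. Im (W q $ i)))"
      using nabla_connection nabla_flat nabla_torsionfree affine_coordinate[OF lin(1)] affine_coordinate[OF lin(2)]
      by simp
  qed (use nabla_unique in blast)
  have form: "induced_form A \<phi> = pulled_form std_form"
    by (intro ext) (simp add: induced_form_def pulled_form_def dx_dy_eq dW)
  note std = std_form_bilinear std_form_skew std_form_nondeg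
  define W' where "W' q = real_part (\<i> *s \<phi> q)" for q
  have lin': "bounded_linear (\<lambda>v::'n cotangent. real_part (\<i> *s v))"
    by (rule bounded_linear_compose[OF real_part_linear bounded_linear_ii])
  have W': "smooth_map_on A UNIV W'"
    unfolding W'_def by (rule smooth_linear_compose[OF lin' smooth])
  have J: "diff A W p (J v) = diff A W' p v" if "v \<in> tangent_space A p" for p v
    unfolding W'_def diff_linear_compose[OF lin' smooth] dW d\<phi>_J[OF that] ..
  have "special_symplectic_manifold A nabla (pulled_form std_form)"
    unfolding special_symplectic_manifold_def special_complex_manifold_def
    using mfd nabla_connection nabla_flat nabla_torsionfree nablaJ_symmetric[OF W' J]
      pulled_form_symplectic[OF std] pulled_form_parallel[OF std]
    by blast
  moreover have "\<exists>U. p \<in> U \<and> real_special_coordinates A nabla (pulled_form std_form) U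
    (\<lambda>q. \<chi> i. (xV i \<circ> \<phi>) q) (\<lambda>q. \<chi> i. (yV i \<circ> \<phi>) q)" for p
  proof -
    \<comment> \<open>\<open>E\<close> undoes the packing of \<open>x\<close> and \<open>y\<close>
      into one complex vector, since special coordinates are a pair of real vectors.\<close>
    define E :: "complex ^ 'n \<Rightarrow> (real ^ 'n) \<times> (real ^ 'n)"
      where "E a = ((\<chi> i. Re (a $ i)), (\<chi> i. Im (a $ i)))" for a
    define E' :: "(real ^ 'n) \<times> (real ^ 'n) \<Rightarrow> complex ^ 'n"
      where "E' b = (\<chi> i. Complex (fst b $ i) (snd b $ i))" for b
    have "bounded_linear E"
      unfolding linear_conv_bounded_linear[symmetric]
      by (rule linearI) (simp_all add: E_def vec_eq_iff)
    moreover have "bounded_linear E'"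
      unfolding linear_conv_bounded_linear[symmetric]
      by (rule linearI) (simp_all add: E'_def vec_eq_iff complex_eq_iff)
    ultimately obtain U where U: "p \<in> U" "local_coordinates A U (\<lambda>q. E (W q))"
      using linear_W_local_coordinates[of E E' p] by (auto simp: E_def E'_def vec_eq_iff)
    have "real_special_coordinates A nabla (pulled_form std_form) U
      (\<lambda>q. \<chi> i. Re (W q $ i)) (\<lambda>q. \<chi> i. Im (W q $ i))"
      unfolding real_special_coordinates_def
    proof (intro conjI allI ballI)
      show "local_coordinates A U (\<lambda>q. ((\<chi> i. Re (W q $ i)), (\<chi> i. Im (W q $ i))))"
        using U(2) unfolding E_def .
      show "affine_on A nabla U (\<lambda>q. (\<chi> i. Re (W q $ i)) $ i)" for i
        using affine_coordinate[OF lin(1)] by simp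
      show "affine_on A nabla U (\<lambda>q. (\<chi> i. Im (W q $ i)) $ i)" for i
        using affine_coordinate[OF lin(2)] by simp
      show "pulled_form std_form p u v = 2 * (\<Sum>i\<in>UNIV. wedge (diff A (\<lambda>q. (\<chi> i. Re (W q $ i)) $ i) p)
        (diff A (\<lambda>q. (\<chi> i. Im (W q $ i)) $ i) p) u v)" for p u v
        by (simp add: pulled_form_def std_form_def wedge_def diff_linear_compose[OF lin(1) W]
            diff_linear_compose[OF lin(2) W])
    qed
    then show ?thesis unfolding coord using U(1) by blast
  qed
  ultimately show ?thesis unfolding conn form by blast
qed

end
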